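(* Let $D_n$ be the degree of the sink in a random series-parallel network of size $n$ generated by the binary model. Then \[ \mathbb{E}(D_n)=\frac{1+\sqrt2}{2}\binom{n+\sqrt2-2}{n-1}-\frac{\sqrt2-1}{2}\binom{n-\sqrt2-2}{n-1}\sim\frac{1+\sqrt2}{2}\,\frac{n^{\sqrt2-1}}{\Gamma(\sqrt2)} . \] Moreover, as $n\to\infty$, $D_n/n^{\sqrt2-1}\xrightarrow{(d)}D$, where $D$ is characterized by \[ \mathbb{E}(D^r)=\frac{r!\,(r(\sqrt2-1)+1)\,c_r}{\Gamma(r(\sqrt2-1)+1)},\quad r\ge0, \] with $c_0=1$, $c_1=\frac{1+\sqrt2}{2\sqrt2}$ and \[ c_r=\frac{1}{(r(\sqrt2-1)+1)^2-2}\sum_{k=1}^{r-1}c_kc_{r-k},\quad r\ge2 . \]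
   Context: Binary model: a series-parallel network is a directed multigraph with a source and a sink; its size is its number of edges. At step $1$ it is a single edge from source to sink. At step $n\ge2$ one of the $n-1$ edges, say $(x,y)$, is chosen uniformly at random; if $x$ has out-degree $1$, an additional parallel edge $(x,y)$ is added; otherwise ($x$ has out-degree $2$) the edge $(x,y)$ is replaced by $(x,z),(z,y)$ with $z$ a new node. The degree of the sink is its in-degree. For real $x$, $\binom{x}{k}=x(x-1)\cdots(x-k+1)/k!$. *)

theory Defs
  imports "HOL-Probability.Probability" "Graph_Theory.Digraph"
begin

record sp_network =
  net :: "(nat, nat) pre_digraph"
  source :: nat
  sink :: nat

definition single_edge :: sp_network where
  "single_edge =
    \<lparr> net = \<lparr> verts = {0, 1}, arcs = {0}, tail = (\<lambda>_. 0), head = (\<lambda>_. 1) \<rparr>,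
      source = 0, sink = 1 \<rparr>"

text \<open>For a finite set this is the least natural number outside of it; it names new arcs and nodes.\<close>

definition fresh :: "nat set \<Rightarrow> nat" where
  "fresh A = (LEAST k. k \<notin> A)"

definition add_parallel :: "nat \<Rightarrow> (nat, nat) pre_digraph \<Rightarrow> (nat, nat) pre_digraph" where
  "add_parallel e G = (let f = fresh (arcs G) in
     G \<lparr> arcs := insert f (arcs G),
         tail := (tail G)(f := tail G e),
         head := (head G)(f := head G e) \<rparr>)"

text \<open>An arc \<open>e\<close> from \<open>x\<close> to \<open>y\<close> is replaced by an arc from \<open>x\<close> to a new node \<open>z\<close>, which
  reuses the name \<open>e\<close>, and a new arc from \<open>z\<close> to \<open>y\<close>.\<close>

definition subdivide :: "nat \<Rightarrow> (nat, nat) pre_digraph \<Rightarrow> (nat, nat) pre_digraph" where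
  "subdivide e G = (let f = fresh (arcs G); z = fresh (verts G) in
     G \<lparr> verts := insert z (verts G),
         arcs := insert f (arcs G),
         tail := (tail G)(f := z),
         head := (head G)(e := z, f := head G e) \<rparr>)"

definition grow :: "nat \<Rightarrow> sp_network \<Rightarrow> sp_network" where
  "grow e N =
    (if out_degree (net N) (tail (net N) e) = 1
     then N \<lparr> net := add_parallel e (net N) \<rparr>
     else N \<lparr> net := subdivide e (net N) \<rparr>)"

definition random_step :: "sp_network \<Rightarrow> sp_network pmf" where
  "random_step N = map_pmf (\<lambda>e. grow e N) (pmf_of_set (arcs (net N)))"

text \<open>The law of the random network of size \<open>n \<ge> 1\<close>; the value at \<open>n = 0\<close> is a dummy.\<close>

fun binary_model :: "nat \<Rightarrow> sp_network pmf" where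
  "binary_model 0 = return_pmf single_edge"
| "binary_model (Suc 0) = return_pmf single_edge"
| "binary_model (Suc (Suc n)) = bind_pmf (binary_model (Suc n)) random_step"

definition sink_degree :: "sp_network \<Rightarrow> nat" where
  "sink_degree N = in_degree (net N) (sink N)"

definition expected_sink_degree :: "nat \<Rightarrow> real" where
  "expected_sink_degree n = measure_pmf.expectation (binary_model n) (\<lambda>N. real (sink_degree N))"

definition scaled_sink_degree_law :: "nat \<Rightarrow> real measure" where
  "scaled_sink_degree_law n =
    distr (measure_pmf (binary_model n)) borel
      (\<lambda>N. real (sink_degree N) / real n powr (sqrt 2 - 1))"

fun limit_coeff :: "nat \<Rightarrow> real" where
  "limit_coeff r =
    (if r = 0 then 1
     else if r = 1 then (1 + sqrt 2) / (2 * sqrt 2)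
     else 1 / ((real r * (sqrt 2 - 1) + 1)\<^sup>2 - 2) *
       (\<Sum>k = 1..r - 1. limit_coeff k * limit_coeff (r - k)))"

declare limit_coeff.simps [simp del]

definition limit_moment :: "nat \<Rightarrow> real" where
  "limit_moment r =
    fact r * (real r * (sqrt 2 - 1) + 1) * limit_coeff r / Gamma (real r * (sqrt 2 - 1) + 1)"

definition has_moments :: "real measure \<Rightarrow> (nat \<Rightarrow> real) \<Rightarrow> bool" where
  "has_moments M m \<longleftrightarrow>
    (\<forall>r. integrable M (\<lambda>x. x ^ r) \<and> integral\<^sup>L M (\<lambda>x. x ^ r) = m r)"

end

theory Submission
  imports Defs "HOL-Real_Asymp.Real_Asymp"
begin

text \<open>
  Call an arc into the sink thin if its tail has out-degree 1, and thick otherwise. If \<open>A\<close> and \<open>B\<close>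
  count these arcs, then choosing a thin arc changes \<open>(A, B)\<close> by \<open>(-1, 2)\<close>, choosing a thick one by
  \<open>(1, -1)\<close>, and all other choices leave it fixed: a Polya urn with eigenvalues \<open>\<lambda> = \<surd>2 - 1\<close> and
  \<open>-1 - \<surd>2\<close>. Every eigenfunction of the urn generator with eigenvalue \<open>\<mu>\<close> has expectation
  proportional to the binomial coefficient of \<open>n - 1 + \<mu>\<close> over \<open>n - 1\<close>. Applied to the two linear
  eigenfunctions this gives the mean.

  For the limit law let \<open>b(s) = \<Sum> c\<^sub>r s\<^sup>r\<close> and \<open>a = b + \<lambda> s b'\<close>. The recursion for \<open>c\<^sub>r\<close> says precisely
  that \<open>\<lambda> s a' = b\<^sup>2 - a\<close>, so the generator acts on \<open>a\<^sup>A b\<^sup>B\<close> as \<open>\<lambda> s d/ds\<close>, and the coefficient of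
  \<open>s\<^sup>r\<close> is an eigenfunction with eigenvalue \<open>r \<lambda>\<close>. It is a polynomial with leading part
  \<open>(c\<^sub>1 (\<surd>2 A + B))\<^sup>r / r!\<close>, which yields all moments of \<open>c\<^sub>1 (\<surd>2 A + B) / n\<^sup>\<lambda>\<close> in the limit.
  The difference between \<open>A + B\<close> and \<open>c\<^sub>1 (\<surd>2 A + B)\<close> is a multiple of \<open>\<surd>2 A - B\<close>, which is negligible
  in \<open>L\<^sup>2\<close>. Since \<open>c\<^sub>r\<close> grows at most geometrically, the moments determine the limit.
\<close>

section \<open>The method of moments\<close>

lemma has_momentsD:
  assumes "has_moments M m"
  shows "integrable M (\<lambda>x. x ^ r)" "integral\<^sup>L M (\<lambda>x. x ^ r) = m r"
  using assms by (auto simp: has_moments_def)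

text \<open>The moments fix the Taylor polynomials of the characteristic function, and the error at
  degree 2n is at most 2 |t|^(2n) m(2n) / (2n)!. If these errors vanish along some sequence of
  degrees, the two characteristic functions agree.\<close>

lemma moment_determinacy:
  assumes M: "real_distribution M" "has_moments M m" and N: "real_distribution N" "has_moments N m"
    and small: "\<And>t::real. t > 0 \<Longrightarrow> (\<lambda>j. t ^ (2 * k j) * m (2 * k j) / fact (2 * k j)) \<longlonglongrightarrow> 0"
  shows "M = N"
proof (rule Levy_uniqueness[OF M(1) N(1)], rule ext)
  fix t :: real
  \<comment> \<open>Even degrees are used because there the absolute moment in the error bound is
    the moment itself.\<close>
  have approx: "cmod (char L t - (\<Sum>i\<le>2 * n. (\<i> * t) ^ i / fact i * m i))
      \<le> 2 * (\<bar>t\<bar> ^ (2 * n) * m (2 * n) / fact (2 * n))"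
    if "real_distribution L" "has_moments L m" for L n
    using real_distribution.char_approx1[OF that(1), of "2 * n" t] has_momentsD[OF that(2)]
    by (simp add: power_even_abs)
  show "char M t = char N t"
  proof (cases "t = 0")
    case True
    then show ?thesis using M(1) N(1) by (simp add: real_distribution.char_zero)
  next
    case False
    have "cmod (char M t - char N t) \<le> 4 * (\<bar>t\<bar> ^ (2 * n) * m (2 * n) / fact (2 * n))" for n
      using norm_triangle_ineq4[of "char M t - (\<Sum>i\<le>2 * n. (\<i> * t) ^ i / fact i * m i)"
          "char N t - (\<Sum>i\<le>2 * n. (\<i> * t) ^ i / fact i * m i)"]
        approx[OF M, of n] approx[OF N, of n] by simp
    moreover have "(\<lambda>j. 4 * (\<bar>t\<bar> ^ (2 * k j) * m (2 * k j) / fact (2 * k j))) \<longlonglongrightarrow> 4 * 0"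
      using False by (intro tendsto_mult tendsto_const small) auto
    ultimately have "cmod (char M t - char N t) \<le> 0"
      by (intro LIMSEQ_le_const[where X="\<lambda>j. 4 * (\<bar>t\<bar> ^ (2 * k j) * m (2 * k j) / fact (2 * k j))"]) auto
    then show ?thesis by simp
  qed
qed

text \<open>When the clamp acts, |x| > K and so |x| <= x^2 / K: truncating costs at most a second
  moment over K.\<close>

lemma clamp_error:
  fixes x K :: real
  assumes "K > 0"
  shows "\<bar>x - max (- K) (min K x)\<bar> \<le> x\<^sup>2 / K"
proof (cases "\<bar>x\<bar> \<le> K")
  case True
  then show ?thesis using assms by auto
next
  case False
  then have "\<bar>x - max (- K) (min K x)\<bar> \<le> \<bar>x\<bar>" using assms by auto
  also have "\<dots> \<le> x\<^sup>2 / K"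
    using False assms mult_left_mono[of K "\<bar>x\<bar>" "\<bar>x\<bar>"] by (simp add: field_simps power2_eq_square)
  finally show ?thesis .
qed

text \<open>Weak convergence controls only bounded continuous functions, so powers are truncated.
  Even powers of the limit are integrable by monotone convergence, all others by domination. For the
  values, the truncation error under \<open>\<mu> n\<close> is at most
  \<open>C (2 * r) / real (Suc K)\<close> uniformly in n, which lets the two limits be
  exchanged.\<close>

lemma has_moments_weak_limit:
  assumes \<mu>: "\<And>n. real_distribution (\<mu> n)" and M: "real_distribution M"
    and conv: "weak_conv_m \<mu> M"
    and int: "\<And>n r. integrable (\<mu> n) (\<lambda>x. x ^ r)"
    and lim: "\<And>r. (\<lambda>n. integral\<^sup>L (\<mu> n) (\<lambda>x. x ^ r)) \<longlonglongrightarrow> m r"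
  shows "has_moments M m"
proof -
  interpret M: real_distribution M by fact
  interpret \<mu>: real_distribution "\<mu> n" for n by fact
  have "\<exists>C. \<forall>n. integral\<^sup>L (\<mu> n) (\<lambda>x. x ^ r) \<le> C" for r
    using convergent_imp_Bseq[OF convergentI[OF lim[of r]]] unfolding Bseq_def
    by (metis abs_le_D1 real_norm_def)
  then obtain C where C: "integral\<^sup>L (\<mu> n) (\<lambda>x. x ^ r) \<le> C r" for n r by metis
  have wlim: "(\<lambda>n. integral\<^sup>L (\<mu> n) f) \<longlonglongrightarrow> integral\<^sup>L M f"
    if "continuous_on UNIV f" "\<And>x. norm (f x) \<le> B" for f :: "real \<Rightarrow> real" and B
    using that by (intro weak_conv_imp_integral_bdd_continuous_conv[OF \<mu> M conv, of f B])
      (auto simp: continuous_on_eq_continuous_at)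
  have even_int: "integrable M (\<lambda>x. x ^ (2 * r))" for r
  proof -
    define h where "h K x = min (real K) (x ^ (2 * r))" for K and x :: real
    have h0: "0 \<le> h K x" "h K x \<le> real K" for K x
      by (auto simp: h_def zero_le_even_power)
    have hcont: "continuous_on UNIV (h K)" for K
      unfolding h_def by (intro continuous_intros)
    have hmeas[measurable]: "h K \<in> borel_measurable borel" for K
      using hcont by (rule borel_measurable_continuous_onI)
    have hint: "integrable M (h K)" for K
      using h0 by (intro M.integrable_const_bound[where B="real K"]) auto
    have hint': "integrable (\<mu> n) (h K)" for K n
      using h0 by (intro \<mu>.integrable_const_bound[where B="real K"]) auto
    have bound: "integral\<^sup>L M (h K) \<le> C (2 * r)" for K
    proof (rule LIMSEQ_le_const2[OF wlim[OF hcont]])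
      show "norm (h K x) \<le> real K" for x using h0[of K x] by simp
      have "integral\<^sup>L (\<mu> n) (h K) \<le> C (2 * r)" for n
        using integral_mono[OF hint' int, of n K "2 * r"] C[of n "2 * r"] by (simp add: h_def)
      then show "\<exists>N. \<forall>n\<ge>N. integral\<^sup>L (\<mu> n) (h K) \<le> C (2 * r)" by blast
    qed
    have mono: "h K x \<le> h L x" if "K \<le> L" for K L x
      using that by (auto simp: h_def)
    have "incseq (\<lambda>K. integral\<^sup>L M (h K))"
      by (intro incseq_SucI integral_mono hint mono) simp
    then obtain l where l: "(\<lambda>K. integral\<^sup>L M (h K)) \<longlonglongrightarrow> l"
      using bound by (rule incseq_convergent[rule_format]) blast
    show ?thesis
    proof (rule integrable_monotone_convergence[OF hint _ _ l])
      show "AE x in M. mono (\<lambda>K. h K x)" using mono by (auto simp: mono_def)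
      have "(\<lambda>K. h K x) \<longlonglongrightarrow> x ^ (2 * r)" for x
      proof (rule tendsto_eventually)
        obtain N where "x ^ (2 * r) \<le> real N" using real_arch_simple by blast
        then show "\<forall>\<^sub>F K in sequentially. h K x = x ^ (2 * r)"
          by (intro eventually_sequentiallyI[of N]) (auto simp: h_def)
      qed
      then show "AE x in M. (\<lambda>K. h K x) \<longlonglongrightarrow> x ^ (2 * r)" by simp
    qed simp
  qed
  have int_M: "integrable M (\<lambda>x. x ^ r)" for r
  proof (rule Bochner_Integration.integrable_bound)
    show "integrable M (\<lambda>x. 1 + x ^ (2 * r))" using even_int by simp
    have "\<bar>x ^ r\<bar> \<le> 1 + x ^ (2 * r)" for x :: real
    proof -
      have "0 \<le> (\<bar>x ^ r\<bar> - 1 / 2)\<^sup>2" by simp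
      moreover have "x ^ (2 * r) = (\<bar>x ^ r\<bar>)\<^sup>2" by (simp add: mult.commute flip: power_mult)
      ultimately show ?thesis by (simp add: power2_eq_square algebra_simps)
    qed
    then show "AE x in M. norm (x ^ r) \<le> norm (1 + x ^ (2 * r))"
      by (auto intro: order_trans[OF _ abs_ge_self])
  qed simp
  have "integral\<^sup>L M (\<lambda>x. x ^ r) = m r" for r
  proof -
    \<comment> \<open>The level \<open>Suc K\<close> is never 0, as \<open>clamp_error\<close>
      demands.\<close>
    define f where "f K x = max (- real (Suc K)) (min (real (Suc K)) (x ^ r))" for K and x :: real
    have fb: "norm (f K x) \<le> real (Suc K)" for K x by (auto simp: f_def)
    have fcont: "continuous_on UNIV (f K)" for K unfolding f_def by (intro continuous_intros)
    have fmeas[measurable]: "f K \<in> borel_measurable borel" for K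
      using fcont by (rule borel_measurable_continuous_onI)
    have fint: "integrable (\<mu> n) (f K)" for K n
      using fb by (intro \<mu>.integrable_const_bound[where B="real (Suc K)"]) auto
    have err: "\<bar>x ^ r - f K x\<bar> \<le> x ^ (2 * r) / real (Suc K)" for K x
      using clamp_error[of "real (Suc K)" "x ^ r"] by (simp add: f_def power_mult mult.commute flip: power_mult)
    have "\<bar>integral\<^sup>L (\<mu> n) (\<lambda>x. x ^ r) - integral\<^sup>L (\<mu> n) (f K)\<bar> \<le> C (2 * r) / real (Suc K)" for n K
    proof -
      have "\<bar>integral\<^sup>L (\<mu> n) (\<lambda>x. x ^ r) - integral\<^sup>L (\<mu> n) (f K)\<bar>
          = \<bar>integral\<^sup>L (\<mu> n) (\<lambda>x. x ^ r - f K x)\<bar>"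
        using int fint by simp
      also have "\<dots> \<le> integral\<^sup>L (\<mu> n) (\<lambda>x. \<bar>x ^ r - f K x\<bar>)" by (rule integral_abs_bound)
      also have "\<dots> \<le> integral\<^sup>L (\<mu> n) (\<lambda>x. x ^ (2 * r) / real (Suc K))"
        using int fint err by (intro integral_mono) auto
      also have "\<dots> \<le> C (2 * r) / real (Suc K)"
        using C by (simp add: divide_right_mono)
      finally show ?thesis .
    qed
    then have close: "\<bar>m r - integral\<^sup>L M (f K)\<bar> \<le> C (2 * r) / real (Suc K)" for K
      by (intro LIMSEQ_le_const2[OF tendsto_rabs[OF tendsto_diff[OF lim wlim[OF fcont fb]]]]) blast
    have "(\<lambda>K. C (2 * r) / real (Suc K)) \<longlonglongrightarrow> 0"
      using LIMSEQ_Suc[OF lim_const_over_n[of "C (2 * r)"]] by simp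
    then have "(\<lambda>K. m r - integral\<^sup>L M (f K)) \<longlonglongrightarrow> 0"
      by (rule Lim_null_comparison[rotated]) (use close in auto)
    then have "(\<lambda>K. m r - (m r - integral\<^sup>L M (f K))) \<longlonglongrightarrow> m r - 0"
      by (intro tendsto_diff tendsto_const)
    then have "(\<lambda>K. integral\<^sup>L M (f K)) \<longlonglongrightarrow> m r" by simp
    moreover have "(\<lambda>K. integral\<^sup>L M (f K)) \<longlonglongrightarrow> integral\<^sup>L M (\<lambda>x. x ^ r)"
    proof (rule integral_dominated_convergence[where w="\<lambda>x. \<bar>x ^ r\<bar>"])
      have "(\<lambda>K. f K x) \<longlonglongrightarrow> x ^ r" for x
      proof (rule tendsto_eventually)
        obtain N where "\<bar>x ^ r\<bar> \<le> real N" using real_arch_simple by blast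
        then show "\<forall>\<^sub>F K in sequentially. f K x = x ^ r"
          by (intro eventually_sequentiallyI[of N]) (auto simp: f_def)
      qed
      then show "AE x in M. (\<lambda>K. f K x) \<longlonglongrightarrow> x ^ r" by simp
      show "AE x in M. norm (f K x) \<le> \<bar>x ^ r\<bar>" for K by (auto simp: f_def)
    qed (use int_M in auto)
    ultimately show ?thesis by (rule LIMSEQ_unique[symmetric])
  qed
  with int_M show ?thesis by (auto simp: has_moments_def)
qed

lemma tight_second_moment:
  assumes \<mu>: "\<And>n. real_distribution (\<mu> n)"
    and int: "\<And>n. integrable (\<mu> n) (\<lambda>x. x\<^sup>2)"
    and C: "\<And>n. integral\<^sup>L (\<mu> n) (\<lambda>x. x\<^sup>2) \<le> C"
  shows "tight \<mu>"
  unfolding tight_def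
proof (intro conjI allI impI)
  fix \<epsilon> :: real assume \<epsilon>: "\<epsilon> > 0"
  \<comment> \<open>The summand 1 makes a >= 1, hence a^2 >= a; the other makes a \<epsilon> > |C|.
    Markov's bound C / a^2 then falls below \<epsilon>.\<close>
  define a where "a = 1 + \<bar>C\<bar> / \<epsilon>"
  have a: "a \<ge> 1" and ae: "\<bar>C\<bar> < a * \<epsilon>" using \<epsilon> by (auto simp: a_def field_simps)
  have Ca: "\<bar>C\<bar> < a\<^sup>2 * \<epsilon>"
  proof -
    have "a * \<epsilon> \<le> a\<^sup>2 * \<epsilon>" using a \<epsilon> by (simp add: power2_eq_square)
    then show ?thesis using ae by simp
  qed
  have "measure (\<mu> n) {- a<..a} > 1 - \<epsilon>" for n
  proof -
    interpret real_distribution "\<mu> n" by fact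
    have "measure (\<mu> n) {x \<in> space (\<mu> n). x\<^sup>2 \<ge> a\<^sup>2} \<le> integral\<^sup>L (\<mu> n) (\<lambda>x. x\<^sup>2) / a\<^sup>2"
      using a int by (intro integral_Markov_inequality_measure[where A="{}"]) auto
    also have "\<dots> < \<epsilon>" using Ca C[of n] a by (simp add: field_simps)
    finally have "measure (\<mu> n) {x. x\<^sup>2 \<ge> a\<^sup>2} < \<epsilon>" by simp
    moreover have "1 - measure (\<mu> n) {x. x\<^sup>2 \<ge> a\<^sup>2} = measure (\<mu> n) (space (\<mu> n) - {x. x\<^sup>2 \<ge> a\<^sup>2})"
      by (rule prob_compl[symmetric]) simp
    moreover have "measure (\<mu> n) (space (\<mu> n) - {x. x\<^sup>2 \<ge> a\<^sup>2}) \<le> measure (\<mu> n) {- a<..a}"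
    proof (rule finite_measure_mono)
      have "- a < x \<and> x \<le> a" if "\<not> a\<^sup>2 \<le> x\<^sup>2" for x
      proof -
        from that have "\<bar>x\<bar> < \<bar>a\<bar>" unfolding abs_le_square_iff[of a x, symmetric] by simp
        then show ?thesis using a by linarith
      qed
      then show "space (\<mu> n) - {x. x\<^sup>2 \<ge> a\<^sup>2} \<subseteq> {- a<..a}"
        unfolding subset_iff Diff_iff mem_Collect_eq greaterThanAtMost_iff by blast
    qed simp
    ultimately show ?thesis by linarith
  qed
  then show "\<exists>a b. a < b \<and> (\<forall>n. measure (\<mu> n) {a<..b} > 1 - \<epsilon>)"
    using a by (intro exI[of _ "- a"] exI[of _ a]) auto
qed (rule \<mu>)

text \<open>Convergent second moments give tightness. Every subsequential weak limit has the moments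
  m, so by \<open>moment_determinacy\<close> there is only one such limit, and a tight sequence with
  a single possible limit converges.\<close>

theorem method_of_moments:
  assumes \<mu>: "\<And>n. real_distribution (\<mu> n)"
    and int: "\<And>n r. integrable (\<mu> n) (\<lambda>x. x ^ r)"
    and lim: "\<And>r. (\<lambda>n. integral\<^sup>L (\<mu> n) (\<lambda>x. x ^ r)) \<longlonglongrightarrow> m r"
    and small: "\<And>t::real. t > 0 \<Longrightarrow> (\<lambda>j. t ^ (2 * k j) * m (2 * k j) / fact (2 * k j)) \<longlonglongrightarrow> 0"
  obtains D where "real_distribution D" "weak_conv_m \<mu> D" "has_moments D m"
proof -
  obtain C where "\<And>n. integral\<^sup>L (\<mu> n) (\<lambda>x. x\<^sup>2) \<le> C"
    using convergent_imp_Bseq[OF convergentI[OF lim[of 2]]] unfolding Bseq_def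
    by (metis abs_le_D1 real_norm_def)
  then have tight: "tight \<mu>" by (intro tight_second_moment \<mu> int)
  have subseq: "has_moments \<nu> m"
    if "strict_mono s" "real_distribution \<nu>" "weak_conv_m (\<mu> \<circ> s) \<nu>" for s \<nu>
    using that int LIMSEQ_subseq_LIMSEQ[OF lim that(1)]
    by (intro has_moments_weak_limit[of "\<mu> \<circ> s"]) (auto simp: \<mu> o_def)
  obtain s D where s: "strict_mono (s :: nat \<Rightarrow> nat)" and D: "real_distribution D"
    and "weak_conv_m (\<mu> \<circ> s) D"
    using tight_imp_convergent_subsubsequence[OF tight strict_mono_id] by (auto simp: o_def)
  then have mom: "has_moments D m" using subseq by blast
  have "weak_conv_m \<mu> D"
  proof (rule tight_subseq_weak_converge[OF \<mu> D tight])
    fix s \<nu>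
    assume s: "strict_mono s" and \<nu>: "real_distribution \<nu>" and conv: "weak_conv_m (\<mu> \<circ> s) \<nu>"
    have "\<nu> = D"
      by (rule moment_determinacy[OF \<nu> subseq[OF s \<nu> conv] D mom]) (rule small)
    then show "weak_conv_m (\<mu> \<circ> s) D" using conv by simp
  qed
  with D mom show ?thesis by (intro that)
qed

section \<open>Transfer of weak limits between variables close in mean\<close>

lemma iexp_diff_le: "cmod (iexp x - iexp y) \<le> \<bar>x - y\<bar>"
proof -
  have "iexp x - iexp y = iexp y * (iexp (x - y) - 1)"
    by (simp add: algebra_simps flip: exp_add)
  then show ?thesis
    using iexp_approx1[of "x - y" 0] by (simp add: norm_mult)
qed

text \<open>The characteristic functions differ by at most |t| E|X - Y|, so Levy continuity carries
  the limit over. This is used to pass from \<open>urn_weight\<close> to the degree.\<close>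

lemma weak_conv_m_L1_close:
  fixes X Y :: "nat \<Rightarrow> 'a \<Rightarrow> real"
  assumes P: "\<And>n. prob_space (P n)"
    and X[measurable]: "\<And>n. X n \<in> borel_measurable (P n)"
    and Y[measurable]: "\<And>n. Y n \<in> borel_measurable (P n)"
    and int: "\<And>n. integrable (P n) (\<lambda>\<omega>. X n \<omega> - Y n \<omega>)"
    and close: "(\<lambda>n. integral\<^sup>L (P n) (\<lambda>\<omega>. \<bar>X n \<omega> - Y n \<omega>\<bar>)) \<longlonglongrightarrow> 0"
    and D: "real_distribution D" and conv: "weak_conv_m (\<lambda>n. distr (P n) borel (Y n)) D"
  shows "weak_conv_m (\<lambda>n. distr (P n) borel (X n)) D"
proof (rule levy_continuity)
  interpret P: prob_space "P n" for n by fact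
  show "real_distribution (distr (P n) borel (X n))" for n
    by (intro P.real_distribution_distr) simp
  have dY: "real_distribution (distr (P n) borel (Y n))" for n
    by (intro P.real_distribution_distr) simp
  fix t :: real
  have charY: "(\<lambda>n. char (distr (P n) borel (Y n)) t) \<longlonglongrightarrow> char D t"
    by (rule levy_continuity1[OF dY D conv])
  have bound: "cmod (char (distr (P n) borel (X n)) t - char (distr (P n) borel (Y n)) t)
      \<le> \<bar>t\<bar> * integral\<^sup>L (P n) (\<lambda>\<omega>. \<bar>X n \<omega> - Y n \<omega>\<bar>)" for n
  proof -
    have iX: "integrable (P n) (\<lambda>\<omega>. iexp (t * X n \<omega>))" by (intro P.integrable_iexp) auto
    have iY: "integrable (P n) (\<lambda>\<omega>. iexp (t * Y n \<omega>))" by (intro P.integrable_iexp) auto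
    have "char (distr (P n) borel (X n)) t - char (distr (P n) borel (Y n)) t
        = (CLINT \<omega>|P n. iexp (t * X n \<omega>) - iexp (t * Y n \<omega>))"
      using iX iY by (simp add: char_def integral_distr)
    also have "cmod \<dots> \<le> (LINT \<omega>|P n. cmod (iexp (t * X n \<omega>) - iexp (t * Y n \<omega>)))"
      by (rule integral_norm_bound)
    also have "\<dots> \<le> (LINT \<omega>|P n. \<bar>t\<bar> * \<bar>X n \<omega> - Y n \<omega>\<bar>)"
    proof (rule integral_mono)
      show "integrable (P n) (\<lambda>\<omega>. cmod (iexp (t * X n \<omega>) - iexp (t * Y n \<omega>)))"
        using iX iY by simp
      show "integrable (P n) (\<lambda>\<omega>. \<bar>t\<bar> * \<bar>X n \<omega> - Y n \<omega>\<bar>)"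
        using int[of n] by simp
      show "cmod (iexp (t * X n \<omega>) - iexp (t * Y n \<omega>)) \<le> \<bar>t\<bar> * \<bar>X n \<omega> - Y n \<omega>\<bar>" for \<omega>
        using iexp_diff_le[of "t * X n \<omega>" "t * Y n \<omega>"]
        by (simp only: abs_mult[symmetric] right_diff_distrib)
    qed
    finally show ?thesis by simp
  qed
  have "(\<lambda>n. char (distr (P n) borel (X n)) t - char (distr (P n) borel (Y n)) t) \<longlonglongrightarrow> 0"
    by (rule Lim_null_comparison[OF _ tendsto_mult_right_zero[OF close, of "\<bar>t\<bar>"]]) (use bound in auto)
  from tendsto_add[OF this charY] show "(\<lambda>n. char (distr (P n) borel (X n)) t) \<longlonglongrightarrow> char D t"
    by simp
qed (rule D)

section \<open>The coefficients of the limit law\<close>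

abbreviation (input) lam :: real where "lam \<equiv> sqrt 2 - 1"

lemma lam_bounds: "41 / 100 < lam" "lam < 42 / 100"
proof -
  have "141 / 100 < sqrt 2" by (rule real_less_rsqrt) (simp add: power2_eq_square)
  moreover have "sqrt 2 < 142 / 100" by (rule real_less_lsqrt) (simp_all add: power2_eq_square)
  ultimately show "41 / 100 < lam" "lam < 42 / 100" by simp_all
qed

lemma limit_coeff_0: "limit_coeff 0 = 1"
  by (subst limit_coeff.simps) simp

lemma limit_coeff_1: "limit_coeff (Suc 0) = (1 + sqrt 2) / (2 * sqrt 2)"
  by (subst limit_coeff.simps) simp

text \<open>The recursion sums r - 1 products, so a denominator of at least 2 lam (r - 1) lets a
  geometric bound survive the induction.\<close>

lemma limit_coeff_denominator:
  assumes "r \<ge> 2"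
  shows "2 * lam * real (r - 1) \<le> (real r * lam + 1)\<^sup>2 - 2"
    and "0 < (real r * lam + 1)\<^sup>2 - 2"
proof -
  \<comment> \<open>After cancelling 2 r lam the claim reads (r lam)^2 + 2 lam >= 1, which lam >
    0.41 settles for r >= 2.\<close>
  have "(2 * (41 / 100))\<^sup>2 \<le> (real r * lam)\<^sup>2"
    using assms lam_bounds by (intro power_mono mult_mono) auto
  then show *: "2 * lam * real (r - 1) \<le> (real r * lam + 1)\<^sup>2 - 2"
    using assms lam_bounds by (simp add: power2_eq_square of_nat_diff algebra_simps)
  have "0 < 2 * lam * real (r - 1)" using assms lam_bounds by simp
  then show "0 < (real r * lam + 1)\<^sup>2 - 2" using * by linarith
qed

lemma limit_coeff_rec:
  assumes "r \<ge> 2"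
  shows "((real r * lam + 1)\<^sup>2 - 2) * limit_coeff r
    = (\<Sum>k = 1..r - 1. limit_coeff k * limit_coeff (r - k))"
  using assms limit_coeff_denominator(2)[OF assms]
  by (subst limit_coeff.simps) simp

text \<open>The terms k = 0 and k = r add 2 c_r and cancel the -2 of the denominator, giving one
  formula for all r. It covers r = 1 because (lam + 1)^2 = 2.\<close>

lemma limit_coeff_convolution:
  "(\<Sum>k = 0..r. limit_coeff k * limit_coeff (r - k)) = (real r * lam + 1)\<^sup>2 * limit_coeff r"
proof -
  consider "r = 0" | "r = 1" | "r \<ge> 2" by linarith
  then show ?thesis
  proof cases
    case 3
    have "{0..r} = insert 0 (insert r {1..r - 1})" using 3 by auto
    then have "(\<Sum>k = 0..r. limit_coeff k * limit_coeff (r - k))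
        = 2 * limit_coeff r + (\<Sum>k = 1..r - 1. limit_coeff k * limit_coeff (r - k))"
      using 3 by (simp add: limit_coeff_0)
    then show ?thesis using limit_coeff_rec[OF 3] by (simp add: algebra_simps)
  qed (simp_all add: limit_coeff_0 power2_eq_square)
qed

text \<open>\<open>q\<close> gives equality at r = 1. In the step each of the r - 1 products is at
  most (2 lam)^2 q^r, and their total is 2 lam q^r times the lower bound for the
  denominator.\<close>

lemma limit_coeff_bounds:
  defines "q \<equiv> limit_coeff (Suc 0) / (2 * lam)"
  assumes "r \<ge> 1"
  shows "0 \<le> limit_coeff r \<and> limit_coeff r \<le> 2 * lam * q ^ r"
  using assms(2)
proof (induction r rule: less_induct)
  case (less r)
  have q: "0 \<le> q" using lam_bounds by (simp add: q_def limit_coeff_1)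
  show ?case
  proof (cases "r = 1")
    case True
    then show ?thesis using lam_bounds by (simp add: q_def limit_coeff_1)
  next
    case False
    with less.prems have r: "r \<ge> 2" by simp
    let ?S = "\<Sum>k = 1..r - 1. limit_coeff k * limit_coeff (r - k)"
    let ?d = "(real r * lam + 1)\<^sup>2 - 2"
    have S0: "0 \<le> ?S" using less.IH by (intro sum_nonneg mult_nonneg_nonneg) auto
    have "?S \<le> (\<Sum>k = 1..r - 1. (2 * lam)\<^sup>2 * q ^ r)"
    proof (rule sum_mono)
      fix k assume k: "k \<in> {1..r - 1}"
      have "limit_coeff k * limit_coeff (r - k) \<le> (2 * lam * q ^ k) * (2 * lam * q ^ (r - k))"
        using less.IH[of k] less.IH[of "r - k"] k q lam_bounds by (intro mult_mono) auto
      also have "\<dots> = (2 * lam)\<^sup>2 * (q ^ k * q ^ (r - k))" by (simp add: power2_eq_square)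
      also have "q ^ k * q ^ (r - k) = q ^ r" using k by (auto simp flip: power_add intro: arg_cong)
      finally show "limit_coeff k * limit_coeff (r - k) \<le> (2 * lam)\<^sup>2 * q ^ r" .
    qed
    also have "\<dots> = (2 * lam * real (r - 1)) * (2 * lam * q ^ r)"
      by (simp add: power2_eq_square)
    also have "\<dots> \<le> ?d * (2 * lam * q ^ r)"
      using limit_coeff_denominator(1)[OF r] q lam_bounds by (intro mult_right_mono) auto
    finally have "?d * limit_coeff r \<le> ?d * (2 * lam * q ^ r)" unfolding limit_coeff_rec[OF r] .
    moreover have "0 \<le> ?d * limit_coeff r" unfolding limit_coeff_rec[OF r] by (rule S0)
    ultimately show ?thesis
      using limit_coeff_denominator(2)[OF r] by (simp only: mult_le_cancel_left_pos zero_le_mult_iff) auto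
  qed
qed

text \<open>Along r = 6 j the index is even and r lam > j, so the Gamma value dividing the moment is
  at least j!, while r! cancels and c_r grows geometrically. What remains is at most a constant
  times x^j / j!.\<close>

lemma limit_moment_small:
  fixes t :: real
  assumes "t > 0"
  shows "(\<lambda>j. t ^ (2 * (3 * j)) * limit_moment (2 * (3 * j)) / fact (2 * (3 * j))) \<longlonglongrightarrow> 0"
proof -
  define q where "q = limit_coeff (Suc 0) / (2 * lam)"
  have q: "0 < q" using lam_bounds by (simp add: q_def limit_coeff_1 add_pos_pos)
  have "(\<lambda>j. (7 * (t * q) ^ 6) ^ j / fact j :: real) \<longlonglongrightarrow> 0"
    using summable_LIMSEQ_zero[OF summable_exp[of "7 * (t * q) ^ 6"]]
    by (simp add: divide_inverse mult.commute)
  then have lim: "(\<lambda>j. 2 * lam * ((7 * (t * q) ^ 6) ^ j / fact j)) \<longlonglongrightarrow> 0"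
    by (rule tendsto_mult_right_zero)
  show ?thesis
  proof (rule Lim_null_comparison[OF _ lim], rule eventually_sequentiallyI[of 1])
    fix j :: nat assume j: "j \<ge> 1"
    let ?r = "2 * (3 * j)"
    have rl: "real ?r * lam \<le> 6 * real j" "real j < real ?r * lam"
      using lam_bounds j by (simp_all add: mult_left_le)
    \<comment> \<open>j >= 1 puts both arguments at 2 or beyond, where Gamma increases.\<close>
    have "Gamma (1 + real j) < Gamma (real ?r * lam + 1)"
      using rl j by (intro Gamma_real_strict_mono) auto
    then have G: "fact j \<le> Gamma (real ?r * lam + 1)" by (simp add: Gamma_fact)
    have c: "0 \<le> limit_coeff ?r" "limit_coeff ?r \<le> 2 * lam * q ^ ?r"
      using limit_coeff_bounds[of ?r] j by (auto simp: q_def)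
    have eq: "t ^ ?r * limit_moment ?r / fact ?r
        = t ^ ?r * (real ?r * lam + 1) * limit_coeff ?r / Gamma (real ?r * lam + 1)"
      by (simp add: limit_moment_def)
    have nonneg: "0 \<le> t ^ ?r * (real ?r * lam + 1) * limit_coeff ?r / Gamma (real ?r * lam + 1)"
      using assms c(1) rl(2) G
      by (intro divide_nonneg_nonneg mult_nonneg_nonneg order_trans[OF _ G]) auto
    have "t ^ ?r * (real ?r * lam + 1) * limit_coeff ?r / Gamma (real ?r * lam + 1)
        \<le> t ^ ?r * 7 ^ j * (2 * lam * q ^ ?r) / fact j"
    proof (intro frac_le mult_mono)
      \<comment> \<open>Bernoulli absorbs the linear factor r lam + 1 into a geometric one.\<close>
      have "1 + real j * 6 \<le> 7 ^ j" using Bernoulli_inequality[of "6::real" j] by simp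
      then show "real ?r * lam + 1 \<le> 7 ^ j" using rl by simp
    qed (use assms c G q lam_bounds rl(2) in auto)
    also have "\<dots> = 2 * lam * ((7 * (t * q) ^ 6) ^ j / fact j)"
      by (simp add: power_mult_distrib power_mult)
    finally show "norm (t ^ ?r * limit_moment ?r / fact ?r) \<le> 2 * lam * ((7 * (t * q) ^ 6) ^ j / fact j)"
      unfolding eq real_norm_def abs_of_nonneg[OF nonneg] .
  qed
qed

text \<open>Euler's limit for Gamma with the index shifted by one, since size n means n - 1 growth
  steps; the ratio of n^\<mu> to (n + 1)^\<mu> tends to 1.\<close>

lemma gbinomial_shift_asymp:
  assumes "\<mu> > (- 1 :: real)"
  shows "(\<lambda>n. ((real n - 1 + \<mu>) gchoose (n - 1)) / real n powr \<mu>) \<longlonglongrightarrow> 1 / Gamma (\<mu> + 1)"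
proof (rule LIMSEQ_imp_Suc)
  have "(\<lambda>n. (\<mu> + real n gchoose n) / exp (\<mu> * ln (real n))) \<longlonglongrightarrow> 1 / Gamma (\<mu> + 1)"
    using Gamma_gbinomial[of \<mu>] assms
    by (simp add: rGamma_inverse_Gamma divide_inverse exp_minus add.commute)
  moreover have "(\<lambda>n. real n powr \<mu> / real (Suc n) powr \<mu>) \<longlonglongrightarrow> 1"
    by real_asymp
  ultimately have "(\<lambda>n. (\<mu> + real n gchoose n) / exp (\<mu> * ln (real n)) * (real n powr \<mu> / real (Suc n) powr \<mu>))
      \<longlonglongrightarrow> 1 / Gamma (\<mu> + 1) * 1"
    by (rule tendsto_mult)
  moreover have "\<forall>\<^sub>F n in sequentially. (\<mu> + real n gchoose n) / exp (\<mu> * ln (real n)) * (real n powr \<mu> / real (Suc n) powr \<mu>)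
      = ((real (Suc n) - 1 + \<mu>) gchoose (Suc n - 1)) / real (Suc n) powr \<mu>"
    using eventually_gt_at_top[of 0] by eventually_elim (simp add: powr_def add.commute)
  ultimately show "(\<lambda>n. ((real (Suc n) - 1 + \<mu>) gchoose (Suc n - 1)) / real (Suc n) powr \<mu>) \<longlonglongrightarrow> 1 / Gamma (\<mu> + 1)"
    unfolding mult_1_right by (rule Lim_transform_eventually)
qed

section \<open>Power series and the polynomial eigenfunctions of the urn\<close>

definition fps_b :: "real fps" where
  "fps_b = Abs_fps limit_coeff"

definition fps_a :: "real fps" where
  "fps_a = Abs_fps (\<lambda>r. (real r * lam + 1) * limit_coeff r)"

lemma fps_b_ode: "fps_const lam * fps_X * fps_deriv fps_b = fps_a - fps_b"
proof (rule fps_ext)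
  show "fps_nth (fps_const lam * fps_X * fps_deriv fps_b) r = fps_nth (fps_a - fps_b) r" for r
    by (cases r) (simp_all add: fps_a_def fps_b_def mult.assoc algebra_simps)
qed

text \<open>The operator f + lam s f' multiplies coefficient r by r lam + 1. It takes b to a;
  applied to a it gives (r lam + 1)^2 c_r, the coefficient of b^2 by
  \<open>limit_coeff_convolution\<close>.\<close>

lemma fps_a_ode: "fps_const lam * fps_X * fps_deriv fps_a = fps_b\<^sup>2 - fps_a"
proof (rule fps_ext)
  fix r
  have "fps_nth (fps_b\<^sup>2) r = (real r * lam + 1)\<^sup>2 * limit_coeff r"
    using limit_coeff_convolution[of r] by (simp add: power2_eq_square fps_mult_nth fps_b_def)
  then show "fps_nth (fps_const lam * fps_X * fps_deriv fps_a) r = fps_nth (fps_b\<^sup>2 - fps_a) r"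
    by (cases r) (simp_all add: fps_a_def fps_b_def mult.assoc algebra_simps power2_eq_square)
qed

definition urn_poly :: "nat \<Rightarrow> nat \<Rightarrow> nat \<Rightarrow> real" where
  "urn_poly r A B = fps_nth (fps_a ^ A * fps_b ^ B) r"

text \<open>(1, 0) is the state of the single edge; the factor r lam + 1 in the limit moments stems
  from here.\<close>

lemma urn_poly_init: "urn_poly r 1 0 = (real r * lam + 1) * limit_coeff r"
  by (simp add: urn_poly_def fps_a_def)

text \<open>Choosing a thin arc trades a factor a for b^2, choosing a thick one trades b for a. By
  the two differential equations the weighted increments form the product rule for lam s d/ds, which
  multiplies coefficient r by r lam.\<close>

lemma urn_poly_eigen:
  "real A * (urn_poly r (A - 1) (B + 2) - urn_poly r A B)
    + real B * (urn_poly r (A + 1) (B - 1) - urn_poly r A B) = real r * lam * urn_poly r A B"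
proof -
  have A: "of_nat A * (fps_a ^ (A - 1) * fps_b ^ (B + 2) - fps_a ^ A * fps_b ^ B)
      = of_nat A * fps_a ^ (A - 1) * fps_b ^ B * (fps_b\<^sup>2 - fps_a)"
    by (cases A) (simp_all add: algebra_simps power2_eq_square)
  have B: "of_nat B * (fps_a ^ (A + 1) * fps_b ^ (B - 1) - fps_a ^ A * fps_b ^ B)
      = of_nat B * fps_a ^ A * fps_b ^ (B - 1) * (fps_a - fps_b)"
    by (cases B) (simp_all add: algebra_simps)
  have "of_nat A * (fps_a ^ (A - 1) * fps_b ^ (B + 2) - fps_a ^ A * fps_b ^ B)
      + of_nat B * (fps_a ^ (A + 1) * fps_b ^ (B - 1) - fps_a ^ A * fps_b ^ B)
      = fps_const lam * fps_X * fps_deriv (fps_a ^ A * fps_b ^ B)"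
    unfolding A B fps_a_ode[symmetric] fps_b_ode[symmetric] fps_deriv_mult fps_deriv_power'
    by (simp add: algebra_simps)
  from arg_cong[where f="\<lambda>f. fps_nth f r", OF this]
  have "real A * (urn_poly r (A - 1) (B + 2) - urn_poly r A B)
      + real B * (urn_poly r (A + 1) (B - 1) - urn_poly r A B)
      = fps_nth (fps_const lam * fps_X * fps_deriv (fps_a ^ A * fps_b ^ B)) r"
    unfolding fps_of_nat[symmetric] by (simp only: urn_poly_def fps_add_nth fps_sub_nth fps_mult_left_const_nth)
  also have "\<dots> = real r * lam * urn_poly r A B"
    unfolding urn_poly_def mult.assoc by (cases r) (simp_all del: fps_deriv_mult)
  finally show ?thesis .
qed

text \<open>The linear eigenfunction of the urn with eigenvalue lam, see
  \<open>drift_weight\<close>.\<close>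

definition urn_weight :: "nat \<Rightarrow> nat \<Rightarrow> real" where
  "urn_weight A B = sqrt 2 * real A + real B"

text \<open>Allows lower powers of the weight to be bounded by higher ones.\<close>

lemma urn_weight_ge1:
  assumes "A + B > 0"
  shows "1 \<le> urn_weight A B"
proof -
  have "real A + real B \<le> sqrt 2 * real A + real B"
    using lam_bounds by (intro add_mono) (simp_all add: mult_le_cancel_right1)
  moreover have "1 \<le> real (A + B)" using assms by linarith
  ultimately show ?thesis by (simp add: urn_weight_def)
qed

text \<open>With the logarithmic derivatives \<open>\<alpha> = a' / a\<close> and \<open>\<beta> = b' / b\<close>, the series \<open>G = a\<^sup>A b\<^sup>B\<close> satisfies
  \<open>G' = (A \<alpha> + B \<beta>) G\<close>. This expresses each coefficient of \<open>G\<close> by the previous ones; only the constant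
  term of \<open>A \<alpha> + B \<beta>\<close> contributes to the leading part. The extra factor \<open>urn_weight A B\<close> on the left
  avoids the exponent \<open>r - 1\<close> on the right.\<close>

lemma urn_poly_leading:
  "\<exists>K. \<forall>A B. A + B > 0 \<longrightarrow>
    \<bar>urn_poly r A B - (limit_coeff 1 * urn_weight A B) ^ r / fact r\<bar> * urn_weight A B
      \<le> K * urn_weight A B ^ r"
proof (induction r rule: less_induct)
  case (less r)
  define \<alpha> where "\<alpha> = fps_deriv fps_a * inverse fps_a"
  define \<beta> where "\<beta> = fps_deriv fps_b * inverse fps_b"
  let ?c = "limit_coeff 1"
  have c: "0 \<le> ?c" using limit_coeff_bounds[of 1] by simp
  have nth_0: "fps_nth fps_a 0 = 1" "fps_nth fps_b 0 = 1"
    by (simp_all add: fps_a_def fps_b_def limit_coeff_0)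
  have log_deriv: "fps_deriv fps_a = fps_a * \<alpha>" "fps_deriv fps_b = fps_b * \<beta>"
    using inverse_mult_eq_1[of fps_a] inverse_mult_eq_1[of fps_b] nth_0
    by (simp_all add: \<alpha>_def \<beta>_def mult.commute mult.assoc)
  have \<alpha>\<beta>0: "fps_nth \<alpha> 0 = sqrt 2 * ?c" "fps_nth \<beta> 0 = ?c"
    by (simp_all add: \<alpha>_def \<beta>_def fps_a_def fps_b_def limit_coeff_0)
  define M where "M k = \<bar>fps_nth \<alpha> k\<bar> + \<bar>fps_nth \<beta> k\<bar>" for k
  define L where "L k A B = real A * fps_nth \<alpha> k + real B * fps_nth \<beta> k" for k A B
  have L0: "L 0 A B = ?c * urn_weight A B" for A B
    by (simp add: L_def \<alpha>\<beta>0 urn_weight_def algebra_simps)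
  have L_le: "\<bar>L k A B\<bar> \<le> M k * urn_weight A B" for k A B
  proof -
    have "real A * \<bar>fps_nth \<alpha> k\<bar> + real B * \<bar>fps_nth \<beta> k\<bar>
        \<le> urn_weight A B * \<bar>fps_nth \<alpha> k\<bar> + urn_weight A B * \<bar>fps_nth \<beta> k\<bar>"
      using lam_bounds
      by (intro add_mono mult_right_mono) (auto simp: urn_weight_def mult_le_cancel_right1 add_increasing add_increasing2)
    then show ?thesis
      unfolding L_def M_def
      by (intro order_trans[OF abs_triangle_ineq]) (simp add: abs_mult algebra_simps)
  qed
  have rec: "real (Suc n) * urn_poly (Suc n) A B = (\<Sum>i = 0..n. urn_poly i A B * L (n - i) A B)" for n A B
  proof -
    have "fps_deriv (fps_a ^ A * fps_b ^ B)
        = (fps_a ^ A * fps_b ^ B) * (of_nat A * \<alpha> + of_nat B * \<beta>)"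
      unfolding fps_deriv_mult fps_deriv_power' log_deriv
      by (cases A; cases B) (simp_all add: algebra_simps)
    from arg_cong[where f="\<lambda>f. fps_nth f n", OF this] show ?thesis
      unfolding fps_of_nat[symmetric] fps_mult_nth[of "fps_a ^ A * fps_b ^ B"] fps_deriv_nth
      by (simp add: urn_poly_def L_def)
  qed
  show ?case
  proof (cases r)
    case 0
    then show ?thesis by (auto simp: urn_poly_def nth_0 fps_nth_power_0 intro!: exI[of _ 0])
  next
    case (Suc n)
    have "\<forall>i\<in>{..n}. \<exists>K. \<forall>A B. A + B > 0 \<longrightarrow>
        \<bar>urn_poly i A B - (?c * urn_weight A B) ^ i / fact i\<bar> * urn_weight A B \<le> K * urn_weight A B ^ i"
      using less.IH Suc by auto
    then obtain K where K: "\<bar>urn_poly i A B - (?c * urn_weight A B) ^ i / fact i\<bar> * urn_weight A B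
        \<le> K i * urn_weight A B ^ i" if "i \<le> n" "A + B > 0" for i A B
      by (metis atMost_iff)
    show ?thesis
    proof (intro exI allI impI)
      fix A B :: nat assume AB: "A + B > 0"
      define u where "u = urn_weight A B"
      have u: "1 \<le> u" using urn_weight_ge1[OF AB] by (simp add: u_def)
      have K': "\<bar>urn_poly i A B - (?c * u) ^ i / fact i\<bar> * u \<le> K i * u ^ i" if "i \<le> n" for i
        using K[OF that AB] by (simp add: u_def)
      have K0: "0 \<le> K i" if "i \<le> n" for i
      proof -
        have "0 \<le> K i * u ^ i" using order_trans[OF _ K'[OF that]] u by simp
        moreover have "0 < u ^ i" using u by simp
        ultimately show ?thesis by (simp add: zero_le_mult_iff)
      qed
      have P: "\<bar>urn_poly i A B\<bar> \<le> (K i + ?c ^ i) * u ^ i" if "i \<le> n" for i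
      proof -
        have "\<bar>urn_poly i A B - (?c * u) ^ i / fact i\<bar> * 1 \<le> \<bar>urn_poly i A B - (?c * u) ^ i / fact i\<bar> * u"
          using u by (intro mult_left_mono) auto
        moreover have "0 \<le> (?c * u) ^ i" using c u by simp
        then have "(?c * u) ^ i / fact i \<le> (?c * u) ^ i" "0 \<le> (?c * u) ^ i / fact i"
          using mult_left_mono[OF fact_ge_1[of i]] by (simp_all add: divide_le_eq)
        ultimately show ?thesis using K'[OF that] by (simp add: power_mult_distrib algebra_simps)
      qed
      \<comment> \<open>Only the term i = n contains \<open>L 0\<close>. Its value c u turns the
        leading part of order n into n + 1 times that of order n + 1, so only the error of order n
        survives from this term.\<close>
      have split: "real (Suc n) * (urn_poly (Suc n) A B - (?c * u) ^ Suc n / fact (Suc n))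
          = (urn_poly n A B - (?c * u) ^ n / fact n) * (?c * u) + (\<Sum>i<n. urn_poly i A B * L (n - i) A B)"
        using rec[of n A B] L0[of A B]
        by (simp add: atLeast0AtMost lessThan_Suc_atMost[symmetric] algebra_simps u_def del: of_nat_Suc)
      have "\<bar>urn_poly (Suc n) A B - (?c * u) ^ Suc n / fact (Suc n)\<bar> * u
          \<le> \<bar>real (Suc n) * (urn_poly (Suc n) A B - (?c * u) ^ Suc n / fact (Suc n))\<bar> * u"
        using u by (intro mult_right_mono) (auto simp: abs_mult mult_le_cancel_right1)
      also have "\<dots> \<le> (\<bar>urn_poly n A B - (?c * u) ^ n / fact n\<bar> * (?c * u)
          + (\<Sum>i<n. \<bar>urn_poly i A B\<bar> * \<bar>L (n - i) A B\<bar>)) * u"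
        unfolding split using u c
        by (intro mult_right_mono order_trans[OF abs_triangle_ineq] add_mono order_trans[OF sum_abs])
          (auto simp: abs_mult)
      also have "\<dots> = (\<bar>urn_poly n A B - (?c * u) ^ n / fact n\<bar> * u) * (?c * u)
          + (\<Sum>i<n. \<bar>urn_poly i A B\<bar> * \<bar>L (n - i) A B\<bar> * u)"
        by (simp add: algebra_simps sum_distrib_left)
      also have "\<dots> \<le> (K n * u ^ n) * (?c * u) + (\<Sum>i<n. (K i + ?c ^ i) * M (n - i) * u ^ Suc n)"
      proof (intro add_mono sum_mono mult_right_mono)
        fix i assume "i \<in> {..<n}"
        then have i: "i < n" by simp
        have "\<bar>urn_poly i A B\<bar> * \<bar>L (n - i) A B\<bar> * u
            \<le> ((K i + ?c ^ i) * u ^ i) * (M (n - i) * u) * u"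
          using P[of i] L_le[of "n - i" A B] i u c K0[of i]
          by (intro mult_right_mono mult_mono) (auto simp: u_def)
        also have "\<dots> = (K i + ?c ^ i) * M (n - i) * u ^ (i + 2)"
          by (simp add: power2_eq_square power_add algebra_simps)
        \<comment> \<open>Since i < n and u >= 1, the exponent i + 2 may be raised to n + 1.\<close>
        also have "\<dots> \<le> (K i + ?c ^ i) * M (n - i) * u ^ Suc n"
          using i u c K0[of i] by (intro mult_left_mono power_increasing mult_nonneg_nonneg) (auto simp: M_def)
        finally show "\<bar>urn_poly i A B\<bar> * \<bar>L (n - i) A B\<bar> * u \<le> (K i + ?c ^ i) * M (n - i) * u ^ Suc n" .
      qed (use K' u c in auto)
      also have "\<dots> = (K n * ?c + (\<Sum>i<n. (K i + ?c ^ i) * M (n - i))) * u ^ Suc n"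
        by (simp add: algebra_simps sum_distrib_left sum_distrib_right)
      finally show "\<bar>urn_poly r A B - (?c * urn_weight A B) ^ r / fact r\<bar> * urn_weight A B
          \<le> (K n * ?c + (\<Sum>i<n. (K i + ?c ^ i) * M (n - i))) * urn_weight A B ^ r"
        by (simp add: Suc u_def)
    qed
  qed
qed

section \<open>The urn of arcs into the sink\<close>

lemma fresh_notin: "finite A \<Longrightarrow> fresh A \<notin> A"
  unfolding fresh_def by (rule LeastI_ex) (rule ex_new_if_finite[OF infinite_UNIV_nat])

definition thin_arcs :: "sp_network \<Rightarrow> nat set" where
  "thin_arcs N = {e \<in> in_arcs (net N) (sink N). out_degree (net N) (tail (net N) e) = 1}"

text \<open>Stated with \<open>\<noteq> 1\<close> rather than \<open>= 2\<close> to match the test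
  made by \<open>grow\<close>.\<close>

definition thick_arcs :: "sp_network \<Rightarrow> nat set" where
  "thick_arcs N = {e \<in> in_arcs (net N) (sink N). out_degree (net N) (tail (net N) e) \<noteq> 1}"

text \<open>The invariant of growth: finiteness makes fresh names new, and having all tails and the
  sink among the vertices keeps them distinct from the new node.\<close>

definition admissible :: "nat \<Rightarrow> sp_network \<Rightarrow> bool" where
  "admissible n N \<longleftrightarrow> finite (verts (net N)) \<and> finite (arcs (net N)) \<and> card (arcs (net N)) = n
    \<and> tail (net N) ` arcs (net N) \<subseteq> verts (net N) \<and> sink N \<in> verts (net N)"

lemma admissible_single_edge: "admissible 1 single_edge"
  by (simp add: admissible_def single_edge_def)

lemma single_edge_arcs: "thin_arcs single_edge = {0}" "thick_arcs single_edge = {}"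
proof -
  have "out_arcs (net single_edge) 0 = {0}" by (auto simp: out_arcs_def single_edge_def)
  then have deg: "out_degree (net single_edge) 0 = 1" by (simp add: out_degree_def)
  have tail: "tail (net single_edge) e = 0" for e by (simp add: single_edge_def)
  have in_arcs: "in_arcs (net single_edge) (sink single_edge) = {0}"
    by (simp add: in_arcs_def single_edge_def)
  show "thin_arcs single_edge = {0}" "thick_arcs single_edge = {}"
    unfolding thin_arcs_def thick_arcs_def in_arcs tail deg by simp_all
qed

lemma finite_thin_thick:
  assumes "admissible n N"
  shows "finite (thin_arcs N)" "finite (thick_arcs N)"
  using assms by (auto simp: admissible_def thin_arcs_def thick_arcs_def in_arcs_def)

lemma sink_degree_eq:
  assumes "admissible n N"
  shows "sink_degree N = card (thin_arcs N) + card (thick_arcs N)"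
proof -
  have "in_arcs (net N) (sink N) = thin_arcs N \<union> thick_arcs N"
    "thin_arcs N \<inter> thick_arcs N = {}"
    by (auto simp: thin_arcs_def thick_arcs_def)
  then show ?thesis
    using finite_thin_thick[OF assms] by (simp add: sink_degree_def in_degree_def card_Un_disjoint)
qed

text \<open>\<open>e\<close> is the only arc leaving its tail, so only \<open>e\<close> and its twin
  \<open>f\<close> see a changed out-degree. If \<open>e\<close> enters the sink, both become
  thick.\<close>

lemma grow_parallel:
  assumes N: "admissible n N" and e: "e \<in> arcs (net N)"
    and deg: "out_degree (net N) (tail (net N) e) = 1"
  defines "f \<equiv> fresh (arcs (net N))"
  shows "admissible (Suc n) (grow e N)"
    and "thin_arcs (grow e N) = thin_arcs N - {e}"
    and "thick_arcs (grow e N) = (if e \<in> thin_arcs N then thick_arcs N \<union> {e, f} else thick_arcs N)"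
proof -
  define G where "G = net N"
  define G' where "G' = add_parallel e G"
  have grow: "grow e N = N\<lparr>net := G'\<rparr>" using deg by (simp add: grow_def G_def G'_def)
  have f: "f \<notin> arcs G" using N by (simp add: f_def G_def admissible_def fresh_notin)
  have eG: "e \<in> arcs G" using e by (simp add: G_def)
  have G': "verts G' = verts G" "arcs G' = insert f (arcs G)"
    "tail G' = (tail G)(f := tail G e)" "head G' = (head G)(f := head G e)"
    by (simp_all add: G'_def add_parallel_def Let_def f_def G_def)
  have out_e: "out_arcs G (tail G e) = {e}"
  proof -
    obtain a where "out_arcs G (tail G e) = {a}"
      using deg by (auto simp: out_degree_def G_def card_1_singleton_iff)
    moreover have "e \<in> out_arcs G (tail G e)" using eG by simp
    ultimately show ?thesis by simp
  qed
  have out_new: "out_arcs G' (tail G e) = {e, f}" using out_e f by (auto simp: out_arcs_def G')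
  have out_old: "out_arcs G' v = out_arcs G v" if "v \<noteq> tail G e" for v
    using that f by (auto simp: out_arcs_def G')
  have "e \<noteq> f" using eG f by auto
  then have deg_new: "out_degree G' (tail G e) = 2" by (simp add: out_degree_def out_new)
  have deg_old: "out_degree G' v = out_degree G v" if "v \<noteq> tail G e" for v
    using that by (simp add: out_degree_def out_old)
  have uniq: "tail G a = tail G e \<longleftrightarrow> a = e" if "a \<in> arcs G" for a
    using out_e that by (auto simp: out_arcs_def)
  show "admissible (Suc n) (grow e N)"
    using N f eG by (auto simp: admissible_def grow G' G_def)
  show "thin_arcs (grow e N) = thin_arcs N - {e}"
  proof (rule set_eqI)
    fix a show "a \<in> thin_arcs (grow e N) \<longleftrightarrow> a \<in> thin_arcs N - {e}"
      using f \<open>e \<noteq> f\<close> uniq[of a] deg_new deg_old[of "tail G a"]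
      by (cases "a = f"; cases "a = e") (auto simp: thin_arcs_def grow G' G_def[symmetric])
  qed
  show "thick_arcs (grow e N) = (if e \<in> thin_arcs N then thick_arcs N \<union> {e, f} else thick_arcs N)"
  proof (rule set_eqI)
    fix a show "a \<in> thick_arcs (grow e N) \<longleftrightarrow>
        a \<in> (if e \<in> thin_arcs N then thick_arcs N \<union> {e, f} else thick_arcs N)"
      using f eG uniq[of a] deg deg_new deg_old[of "tail G a"]
      by (cases "a = f"; cases "a = e") (auto simp: thin_arcs_def thick_arcs_def grow G' G_def[symmetric])
  qed
qed

text \<open>Out-degrees of old nodes stay, as \<open>e\<close> keeps its tail. If \<open>e\<close>
  entered the sink, it now ends in the new node instead, and \<open>f\<close> enters the sink from
  that node of out-degree 1, so it is thin.\<close>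

lemma grow_subdivide:
  assumes N: "admissible n N" and e: "e \<in> arcs (net N)"
    and deg: "out_degree (net N) (tail (net N) e) \<noteq> 1"
  defines "f \<equiv> fresh (arcs (net N))"
  shows "admissible (Suc n) (grow e N)"
    and "thin_arcs (grow e N) = (if e \<in> thick_arcs N then insert f (thin_arcs N) else thin_arcs N)"
    and "thick_arcs (grow e N) = thick_arcs N - {e}"
proof -
  define G where "G = net N"
  define G' where "G' = subdivide e G"
  define z where "z = fresh (verts G)"
  have grow: "grow e N = N\<lparr>net := G'\<rparr>" using deg by (simp add: grow_def G_def G'_def)
  have f: "f \<notin> arcs G" using N by (simp add: f_def G_def admissible_def fresh_notin)
  have z: "z \<notin> verts G" using N by (simp add: z_def G_def admissible_def fresh_notin)
  have eG: "e \<in> arcs G" using e by (simp add: G_def)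
  have G': "verts G' = insert z (verts G)" "arcs G' = insert f (arcs G)"
    "tail G' = (tail G)(f := z)" "head G' = (head G)(e := z, f := head G e)"
    by (simp_all add: G'_def subdivide_def Let_def f_def G_def z_def)
  have tail_z: "tail G a \<noteq> z" if "a \<in> arcs G" for a
    using that z N by (auto simp: admissible_def G_def)
  have sink_z: "sink N \<noteq> z" using z N by (auto simp: admissible_def G_def)
  have "out_arcs G' z = {f}" using tail_z by (auto simp: out_arcs_def G')
  then have deg_z: "out_degree G' z = 1" by (simp add: out_degree_def)
  have "out_arcs G' v = out_arcs G v" if "v \<noteq> z" for v
    using that f by (auto simp: out_arcs_def G')
  then have deg_old: "out_degree G' v = out_degree G v" if "v \<noteq> z" for v
    using that by (simp add: out_degree_def)
  have ef: "e \<noteq> f" using eG f by auto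
  show "admissible (Suc n) (grow e N)"
    using N f eG by (auto simp: admissible_def grow G' G_def)
  show "thin_arcs (grow e N) = (if e \<in> thick_arcs N then insert f (thin_arcs N) else thin_arcs N)"
  proof (rule set_eqI)
    fix a show "a \<in> thin_arcs (grow e N) \<longleftrightarrow>
        a \<in> (if e \<in> thick_arcs N then insert f (thin_arcs N) else thin_arcs N)"
      using f eG ef tail_z[of a] sink_z deg deg_z deg_old[of "tail G a"]
      by (cases "a = f"; cases "a = e") (auto simp: thin_arcs_def thick_arcs_def grow G' G_def[symmetric])
  qed
  show "thick_arcs (grow e N) = thick_arcs N - {e}"
  proof (rule set_eqI)
    fix a show "a \<in> thick_arcs (grow e N) \<longleftrightarrow> a \<in> thick_arcs N - {e}"
      using f eG ef tail_z[of a] sink_z deg deg_z deg_old[of "tail G a"]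
      by (cases "a = f"; cases "a = e") (auto simp: thick_arcs_def grow G' G_def[symmetric])
  qed
qed

section \<open>Transitions of the urn and the support of the model\<close>

definition thin_degree :: "sp_network \<Rightarrow> nat" where
  "thin_degree N = card (thin_arcs N)"

definition thick_degree :: "sp_network \<Rightarrow> nat" where
  "thick_degree N = card (thick_arcs N)"

lemma admissible_grow:
  "admissible n N \<Longrightarrow> e \<in> arcs (net N) \<Longrightarrow> admissible (Suc n) (grow e N)"
  using grow_parallel(1) grow_subdivide(1) by blast

lemma grow_degrees:
  assumes N: "admissible n N" and e: "e \<in> arcs (net N)"
  shows "e \<in> thin_arcs N \<Longrightarrow> thin_degree (grow e N) = thin_degree N - 1 \<and> thick_degree (grow e N) = thick_degree N + 2"
    and "e \<in> thick_arcs N \<Longrightarrow> thin_degree (grow e N) = thin_degree N + 1 \<and> thick_degree (grow e N) = thick_degree N - 1"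
    and "e \<notin> thin_arcs N \<Longrightarrow> e \<notin> thick_arcs N \<Longrightarrow>
      thin_degree (grow e N) = thin_degree N \<and> thick_degree (grow e N) = thick_degree N"
proof -
  let ?f = "fresh (arcs (net N))"
  have fin: "finite (thin_arcs N)" "finite (thick_arcs N)" by (rule finite_thin_thick[OF N])+
  have "?f \<notin> arcs (net N)" using N by (simp add: admissible_def fresh_notin)
  then have f: "?f \<notin> thin_arcs N" "?f \<notin> thick_arcs N" "?f \<noteq> e"
    using e by (auto simp: thin_arcs_def thick_arcs_def)
  show "thin_degree (grow e N) = thin_degree N - 1 \<and> thick_degree (grow e N) = thick_degree N + 2"
    if thin: "e \<in> thin_arcs N"
  proof -
    have "out_degree (net N) (tail (net N) e) = 1" "e \<notin> thick_arcs N"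
      using thin by (auto simp: thin_arcs_def thick_arcs_def)
    then show ?thesis
      using grow_parallel[OF N e] thin fin f by (simp add: thin_degree_def thick_degree_def)
  qed
  show "thin_degree (grow e N) = thin_degree N + 1 \<and> thick_degree (grow e N) = thick_degree N - 1"
    if thick: "e \<in> thick_arcs N"
  proof -
    have "out_degree (net N) (tail (net N) e) \<noteq> 1"
      using thick by (auto simp: thick_arcs_def)
    then show ?thesis
      using grow_subdivide[OF N e] thick fin f by (simp add: thin_degree_def thick_degree_def)
  qed
  show "thin_degree (grow e N) = thin_degree N \<and> thick_degree (grow e N) = thick_degree N"
    if "e \<notin> thin_arcs N" "e \<notin> thick_arcs N"
    using that grow_parallel[OF N e] grow_subdivide[OF N e]
    by (cases "out_degree (net N) (tail (net N) e) = 1") (simp_all add: thin_degree_def thick_degree_def)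
qed

text \<open>The truncated subtractions are harmless: they matter only where the factor in front is zero.\<close>

definition urn_drift :: "(nat \<Rightarrow> nat \<Rightarrow> real) \<Rightarrow> nat \<Rightarrow> nat \<Rightarrow> real" where
  "urn_drift h A B = real A * (h (A - 1) (B + 2) - h A B) + real B * (h (A + 1) (B - 1) - h A B)"

text \<open>After subtracting the current value from each summand only arcs into the sink
  contribute, with one constant increment per class.\<close>

lemma sum_grow:
  assumes N: "admissible n N"
  shows "(\<Sum>e\<in>arcs (net N). h (thin_degree (grow e N)) (thick_degree (grow e N)))
    = real n * h (thin_degree N) (thick_degree N) + urn_drift h (thin_degree N) (thick_degree N)"
proof -
  let ?A = "thin_degree N" and ?B = "thick_degree N"
  let ?g = "\<lambda>e. h (thin_degree (grow e N)) (thick_degree (grow e N)) - h ?A ?B"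
  have sub: "thin_arcs N \<union> thick_arcs N \<subseteq> arcs (net N)"
    by (auto simp: thin_arcs_def thick_arcs_def)
  have disj: "thin_arcs N \<inter> thick_arcs N = {}"
    by (auto simp: thin_arcs_def thick_arcs_def)
  have fin: "finite (arcs (net N))" and n: "card (arcs (net N)) = n"
    using N by (auto simp: admissible_def)
  have "(\<Sum>e\<in>arcs (net N). ?g e) = (\<Sum>e\<in>thin_arcs N \<union> thick_arcs N. ?g e)"
    using fin sub grow_degrees(3)[OF N] by (intro sum.mono_neutral_right) auto
  also have "\<dots> = (\<Sum>e\<in>thin_arcs N. ?g e) + (\<Sum>e\<in>thick_arcs N. ?g e)"
    using finite_thin_thick[OF N] disj by (intro sum.union_disjoint)
  also have "(\<Sum>e\<in>thin_arcs N. ?g e) = (\<Sum>e\<in>thin_arcs N. h (?A - 1) (?B + 2) - h ?A ?B)"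
    using sub grow_degrees(1)[OF N] by (intro sum.cong) auto
  also have "(\<Sum>e\<in>thick_arcs N. ?g e) = (\<Sum>e\<in>thick_arcs N. h (?A + 1) (?B - 1) - h ?A ?B)"
    using sub grow_degrees(2)[OF N] by (intro sum.cong) auto
  finally show ?thesis
    by (simp add: sum_subtractf n urn_drift_def thin_degree_def[symmetric] thick_degree_def[symmetric])
qed

lemma grow_degrees_pos:
  assumes "admissible n N" "e \<in> arcs (net N)" "thin_degree N + thick_degree N > 0"
  shows "thin_degree (grow e N) + thick_degree (grow e N) > 0"
  using assms(3) grow_degrees[OF assms(1,2)]
  by (cases "e \<in> thin_arcs N"; cases "e \<in> thick_arcs N") auto

text \<open>Finite support makes every real function integrable; a positive degree makes
  \<open>urn_weight_ge1\<close> applicable.\<close>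

lemma binary_model_support:
  "finite (set_pmf (binary_model (Suc n))) \<and>
    (\<forall>N\<in>set_pmf (binary_model (Suc n)). admissible (Suc n) N \<and> thin_degree N + thick_degree N > 0)"
proof (induction n)
  case 0
  then show ?case using admissible_single_edge by (simp add: thin_degree_def single_edge_arcs)
next
  case (Suc n)
  let ?S = "set_pmf (binary_model (Suc n))"
  have fin: "finite ?S"
    and adm: "\<And>N. N \<in> ?S \<Longrightarrow> admissible (Suc n) N"
    and pos: "\<And>N. N \<in> ?S \<Longrightarrow> thin_degree N + thick_degree N > 0"
    using Suc.IH by simp_all
  have arcs: "finite (arcs (net N))" "arcs (net N) \<noteq> {}" if "N \<in> ?S" for N
    using adm[OF that] by (auto simp: admissible_def)
  have support: "set_pmf (binary_model (Suc (Suc n))) = (\<Union>N\<in>?S. (\<lambda>e. grow e N) ` arcs (net N))"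
    by (simp add: random_step_def arcs del: binary_model.simps(2))
  show ?case
    unfolding support
  proof (intro conjI ballI)
    show "finite (\<Union>N\<in>?S. (\<lambda>e. grow e N) ` arcs (net N))"
      using fin arcs by (intro finite_UN_I finite_imageI)
    fix N assume "N \<in> (\<Union>N\<in>?S. (\<lambda>e. grow e N) ` arcs (net N))"
    then obtain M e where M: "M \<in> ?S" and e: "e \<in> arcs (net M)" and N: "N = grow e M"
      by (elim UN_E imageE)
    show "admissible (Suc (Suc n)) N"
      unfolding N by (rule admissible_grow[OF adm[OF M] e])
    show "thin_degree N + thick_degree N > 0"
      unfolding N by (rule grow_degrees_pos[OF adm[OF M] e pos[OF M]])
  qed
qed

lemma binary_model_admissible:
  assumes "n \<ge> 1" "N \<in> set_pmf (binary_model n)"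
  shows "admissible n N" "thin_degree N + thick_degree N > 0"
proof -
  obtain k where k: "n = Suc k" using assms(1) by (cases n) simp_all
  note * = bspec[OF conjunct2[OF binary_model_support[of k]] assms(2)[unfolded k]]
  show "admissible n N" unfolding k by (rule conjunct1[OF *])
  show "thin_degree N + thick_degree N > 0" by (rule conjunct2[OF *])
qed

lemma finite_binary_model: "finite (set_pmf (binary_model n))"
proof (cases n)
  case (Suc k)
  show ?thesis unfolding Suc by (rule conjunct1[OF binary_model_support])
qed simp

section \<open>Expectations of functions of the urn state\<close>

definition urn_expectation :: "nat \<Rightarrow> (nat \<Rightarrow> nat \<Rightarrow> real) \<Rightarrow> real" where
  "urn_expectation n h = measure_pmf.expectation (binary_model n) (\<lambda>N. h (thin_degree N) (thick_degree N))"

lemma integrable_binary_model: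
  fixes g :: "sp_network \<Rightarrow> real"
  shows "integrable (measure_pmf (binary_model n)) g"
  by (rule integrable_measure_pmf_finite[OF finite_binary_model])

lemma urn_expectation_1: "urn_expectation (Suc 0) h = h 1 0"
  by (simp add: urn_expectation_def thin_degree_def thick_degree_def single_edge_arcs)

lemma urn_expectation_Suc:
  assumes "n \<ge> 1"
  shows "urn_expectation (Suc n) h = urn_expectation n h + urn_expectation n (urn_drift h) / real n"
proof -
  obtain k where k: "n = Suc k" using assms by (cases n) auto
  let ?S = "set_pmf (binary_model n)"
  let ?h = "\<lambda>N. h (thin_degree N) (thick_degree N)"
  note finS = finite_binary_model[of n] and adm = binary_model_admissible(1)[OF assms]
  have step: "measure_pmf.expectation (random_step N) ?h
      = ?h N + urn_drift h (thin_degree N) (thick_degree N) / real n" if "N \<in> ?S" for N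
  proof -
    have "finite (arcs (net N))" "arcs (net N) \<noteq> {}" "card (arcs (net N)) = n"
      using adm[OF that] assms by (auto simp: admissible_def)
    then show ?thesis
      using sum_grow[OF adm[OF that], of h] assms
      by (simp add: random_step_def integral_pmf_of_set add_divide_distrib)
  qed
  have "urn_expectation (Suc n) h = measure_pmf.expectation (bind_pmf (binary_model n) random_step) ?h"
    by (simp add: urn_expectation_def k)
  also have "\<dots> = (\<Sum>N\<in>?S. pmf (binary_model n) N * measure_pmf.expectation (random_step N) ?h)"
  proof (subst pmf_expectation_bind[OF finS _ order_refl])
    fix N assume "N \<in> ?S"
    then have "finite (arcs (net N))" "arcs (net N) \<noteq> {}"
      using adm[of N] assms by (auto simp: admissible_def)
    then show "finite (set_pmf (random_step N))" by (simp add: random_step_def set_pmf_of_set)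
  qed simp
  also have "\<dots> = (\<Sum>N\<in>?S. pmf (binary_model n) N * (?h N + urn_drift h (thin_degree N) (thick_degree N) / real n))"
    by (intro sum.cong refl arg_cong2[where f="(*)"] step)
  also have "\<dots> = measure_pmf.expectation (binary_model n) (\<lambda>N. ?h N + urn_drift h (thin_degree N) (thick_degree N) / real n)"
    by (subst integral_measure_pmf[OF finS]) auto
  also have "\<dots> = urn_expectation n h + urn_expectation n (urn_drift h) / real n"
    by (simp add: urn_expectation_def integrable_binary_model)
  finally show ?thesis .
qed

text \<open>Each step from size n multiplies the expectation by (n + \<mu>) / n, and the product of
  these factors is the binomial coefficient.\<close>

lemma urn_expectation_eigen:
  assumes "\<And>A B. urn_drift h A B = \<mu> * h A B" and "n \<ge> 1"
  shows "urn_expectation n h = h 1 0 * ((real n - 1 + \<mu>) gchoose (n - 1))"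
  using assms(2)
proof (induction n rule: dec_induct)
  case base
  then show ?case by (simp add: urn_expectation_1)
next
  case (step n)
  then obtain k where k: "n = Suc k" by (cases n) auto
  have "urn_drift h = (\<lambda>A B. \<mu> * h A B)" using assms(1) by (intro ext)
  then have "urn_expectation n (urn_drift h) = \<mu> * urn_expectation n h"
    by (simp add: urn_expectation_def)
  then have "urn_expectation (Suc n) h = urn_expectation n h * ((real n + \<mu>) / real n)"
    using step.hyps by (simp add: urn_expectation_Suc field_simps)
  also have "\<dots> = h 1 0 * ((real k + \<mu> gchoose k) * ((real k + \<mu> + 1) / real (Suc k)))"
    using step.IH by (simp add: k algebra_simps)
  also have "(real k + \<mu> gchoose k) * ((real k + \<mu> + 1) / real (Suc k)) = (real k + \<mu> + 1) gchoose (Suc k)"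
    using gbinomial_factors[of "real k + \<mu>" k] by (simp add: mult.commute)
  finally show ?case by (simp add: k algebra_simps)
qed

lemma urn_expectation_add:
  "urn_expectation n (\<lambda>A B. h A B + g A B) = urn_expectation n h + urn_expectation n g"
  by (simp add: urn_expectation_def integrable_binary_model)

lemma urn_expectation_cmult: "urn_expectation n (\<lambda>A B. c * h A B) = c * urn_expectation n h"
  by (simp add: urn_expectation_def)

text \<open>Comparing only where \<open>A + B > 0\<close> admits bounds such as
  \<open>urn_poly_leading\<close>.\<close>

lemma urn_expectation_mono:
  assumes le: "\<And>A B. A + B > 0 \<Longrightarrow> h A B \<le> g A B" and n: "n \<ge> 1"
  shows "urn_expectation n h \<le> urn_expectation n g"
  unfolding urn_expectation_def
proof (rule integral_mono_AE[OF integrable_binary_model integrable_binary_model], rule AE_pmfI)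
  fix N assume "N \<in> set_pmf (binary_model n)"
  from binary_model_admissible(2)[OF n this] show "h (thin_degree N) (thick_degree N) \<le> g (thin_degree N) (thick_degree N)"
    by (rule le)
qed

lemma expected_sink_degree_eq:
  assumes "n \<ge> 1"
  shows "expected_sink_degree n = urn_expectation n (\<lambda>A B. real A + real B)"
  unfolding expected_sink_degree_def urn_expectation_def
proof (rule integral_cong_AE, simp, simp, rule AE_pmfI)
  fix N assume "N \<in> set_pmf (binary_model n)"
  from binary_model_admissible(1)[OF assms this] show "real (sink_degree N) = real (thin_degree N) + real (thick_degree N)"
    by (simp add: sink_degree_eq thin_degree_def thick_degree_def)
qed

section \<open>Asymptotics of the sink degree\<close>

lemma drift_weight: "urn_drift urn_weight A B = lam * urn_weight A B"
  by (cases A; cases B) (simp_all add: urn_drift_def urn_weight_def algebra_simps)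

text \<open>The second linear eigenfunction, with negative eigenvalue, see
  \<open>drift_gap\<close>.\<close>

definition urn_gap :: "nat \<Rightarrow> nat \<Rightarrow> real" where
  "urn_gap A B = sqrt 2 * real A - real B"

lemma drift_gap: "urn_drift urn_gap A B = - (1 + sqrt 2) * urn_gap A B"
  by (cases A; cases B) (simp_all add: urn_drift_def urn_gap_def algebra_simps)

lemma drift_poly: "urn_drift (urn_poly r) A B = real r * lam * urn_poly r A B"
  unfolding urn_drift_def by (rule urn_poly_eigen)

text \<open>The degree expanded in the two linear eigenfunctions; the weight enters with exactly the
  coefficient c_1.\<close>

lemma total_eq:
  "real A + real B = limit_coeff 1 * urn_weight A B + (1 / (2 * sqrt 2) - 1 / 2) * urn_gap A B"
  by (simp add: urn_weight_def urn_gap_def limit_coeff_1 field_simps)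

lemma expectation_weight:
  "n \<ge> 1 \<Longrightarrow> urn_expectation n urn_weight = sqrt 2 * ((real n - 1 + lam) gchoose (n - 1))"
  using urn_expectation_eigen[OF drift_weight, of n] by (simp add: urn_weight_def)

lemma expectation_gap:
  "n \<ge> 1 \<Longrightarrow> urn_expectation n urn_gap = sqrt 2 * ((real n - 1 - (1 + sqrt 2)) gchoose (n - 1))"
  using urn_expectation_eigen[OF drift_gap, of n] by (simp add: urn_gap_def)

lemma expected_sink_degree_decomp:
  assumes "n \<ge> 1"
  shows "expected_sink_degree n = limit_coeff 1 * urn_expectation n urn_weight
    + (1 / (2 * sqrt 2) - 1 / 2) * urn_expectation n urn_gap"
  unfolding expected_sink_degree_eq[OF assms] total_eq urn_expectation_add urn_expectation_cmult ..

lemma expected_sink_degree_exact: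
  assumes "n \<ge> 1"
  shows "expected_sink_degree n = (1 + sqrt 2) / 2 * ((real n + sqrt 2 - 2) gchoose (n - 1))
    - (sqrt 2 - 1) / 2 * ((real n - sqrt 2 - 2) gchoose (n - 1))"
proof -
  have "real n - 1 + lam = real n + sqrt 2 - 2" "real n - 1 - (1 + sqrt 2) = real n - sqrt 2 - 2"
    by simp_all
  moreover have "limit_coeff 1 * (sqrt 2 * x) + (1 / (2 * sqrt 2) - 1 / 2) * (sqrt 2 * y)
      = (1 + sqrt 2) / 2 * x - (sqrt 2 - 1) / 2 * y" for x y
    by (simp add: limit_coeff_1 left_diff_distrib) (simp add: field_simps)
  ultimately show ?thesis
    unfolding expected_sink_degree_decomp[OF assms] expectation_weight[OF assms] expectation_gap[OF assms]
    by (simp only:)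
qed

lemma expectation_weight_asymp:
  "(\<lambda>n. urn_expectation n urn_weight / real n powr lam) \<longlonglongrightarrow> sqrt 2 / Gamma (sqrt 2)"
proof -
  have "(\<lambda>n. sqrt 2 * (((real n - 1 + lam) gchoose (n - 1)) / real n powr lam)) \<longlonglongrightarrow> sqrt 2 * (1 / Gamma (lam + 1))"
    by (intro tendsto_mult tendsto_const gbinomial_shift_asymp) (use lam_bounds in auto)
  moreover have "\<forall>\<^sub>F n in sequentially. sqrt 2 * (((real n - 1 + lam) gchoose (n - 1)) / real n powr lam)
      = urn_expectation n urn_weight / real n powr lam"
    using eventually_ge_at_top[of 1] by eventually_elim (simp only: expectation_weight times_divide_eq_right)
  ultimately show ?thesis by (simp add: Lim_transform_eventually)
qed

text \<open>The negative eigenvalue gives the square a negative quadratic drift term, which is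
  dropped; the rest is at most 12 times the weight. The drift of 30 times the weight is 30 lam times
  the weight, and 30 lam > 12.\<close>

lemma expectation_gap_square:
  assumes "n \<ge> 1"
  shows "urn_expectation n (\<lambda>A B. (urn_gap A B)\<^sup>2) \<le> 30 * urn_expectation n urn_weight"
  using assms
proof (induction n rule: dec_induct)
  case base
  have "2 \<le> 30 * sqrt 2" using lam_bounds by simp
  then show ?case by (simp add: urn_expectation_1 urn_gap_def urn_weight_def)
next
  case (step n)
  let ?E = "urn_expectation n"
  have drift: "urn_drift (\<lambda>A B. (urn_gap A B)\<^sup>2) A B \<le> 12 * urn_weight A B" for A B
  proof -
    \<comment> \<open>The linear coefficients are the squared jumps of the gap, (2 + sqrt 2)^2 and
      (1 + sqrt 2)^2.\<close>
    have "urn_drift (\<lambda>A B. (urn_gap A B)\<^sup>2) A B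
        = - 2 * (1 + sqrt 2) * (urn_gap A B)\<^sup>2 + (6 + 4 * sqrt 2) * real A + (3 + 2 * sqrt 2) * real B"
      by (cases A; cases B) (simp_all add: urn_drift_def urn_gap_def power2_eq_square algebra_simps)
    also have "\<dots> \<le> 0 + (12 * sqrt 2) * real A + 12 * real B"
      using lam_bounds by (intro add_mono mult_right_mono mult_nonpos_nonneg) auto
    finally show ?thesis by (simp add: urn_weight_def algebra_simps)
  qed
  have pos: "0 \<le> ?E urn_weight"
    using urn_expectation_mono[of "\<lambda>_ _. 0" urn_weight n] step.hyps urn_weight_ge1
    by (simp add: urn_expectation_def order_trans[OF zero_le_one])
  have "?E (urn_drift (\<lambda>A B. (urn_gap A B)\<^sup>2)) \<le> ?E (\<lambda>A B. 12 * urn_weight A B)"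
    using step.hyps by (intro urn_expectation_mono drift) auto
  then have "urn_expectation (Suc n) (\<lambda>A B. (urn_gap A B)\<^sup>2) \<le> 30 * ?E urn_weight + 12 * ?E urn_weight / real n"
    using step.hyps step.IH
    by (simp add: urn_expectation_Suc urn_expectation_cmult add_mono divide_right_mono)
  also have "\<dots> \<le> 30 * ?E urn_weight + 30 * lam * ?E urn_weight / real n"
    using pos lam_bounds by (intro add_mono divide_right_mono mult_right_mono) auto
  also have "\<dots> = 30 * urn_expectation (Suc n) urn_weight"
  proof -
    have "urn_drift urn_weight = (\<lambda>A B. lam * urn_weight A B)" by (intro ext drift_weight)
    then have "urn_expectation n (urn_drift urn_weight) = lam * ?E urn_weight"
      by (simp only: urn_expectation_cmult)
    then show ?thesis
      unfolding urn_expectation_Suc[OF step.hyps(1)] by (simp only: distrib_left times_divide_eq_right mult.assoc)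
  qed
  finally show ?case .
qed

text \<open>The second moment of the gap is of order at most n^lam, so its mean size is of smaller
  order than n^lam.\<close>

lemma expectation_gap_abs:
  "(\<lambda>n. urn_expectation n (\<lambda>A B. \<bar>urn_gap A B\<bar>) / real n powr lam) \<longlonglongrightarrow> 0"
proof -
  \<comment> \<open>any exponent strictly between \<open>0\<close> and \<open>lam\<close> works: the bound \<open>\<bar>y\<bar> \<le> y\<^sup>2 / s + s\<close> then gives
    two terms of order less than \<open>n powr lam\<close>\<close>
  define s where "s n = real n powr (3 / 4 * lam)" for n
  have s_inv: "(\<lambda>n. 1 / s n) \<longlonglongrightarrow> 0" unfolding s_def using lam_bounds by real_asymp
  have s_small: "(\<lambda>n. s n / real n powr lam) \<longlonglongrightarrow> 0" 
  proof -
    have "(\<lambda>n. real n powr (- (1 / 4 * lam))) \<longlonglongrightarrow> 0" using lam_bounds by real_asymp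
    moreover have "- (1 / 4 * lam) = 3 / 4 * lam - lam" by (simp add: field_simps)
    ultimately show ?thesis by (simp only: s_def powr_diff)
  qed
  have lim: "(\<lambda>n. 30 * (urn_expectation n urn_weight / real n powr lam) * (1 / s n) + s n / real n powr lam) \<longlonglongrightarrow>
      30 * (sqrt 2 / Gamma (sqrt 2)) * 0 + 0"
    by (intro tendsto_add tendsto_mult tendsto_const expectation_weight_asymp s_inv s_small)
  have bound: "norm (urn_expectation n (\<lambda>A B. \<bar>urn_gap A B\<bar>) / real n powr lam)
      \<le> 30 * (urn_expectation n urn_weight / real n powr lam) * (1 / s n) + s n / real n powr lam"
    if n: "n \<ge> 1" for n
  proof -
    have s: "s n > 0" using n by (simp add: s_def)
    have "\<bar>y\<bar> \<le> (1 / s n) * y\<^sup>2 + s n" for y :: real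
    proof -
      have "0 \<le> (\<bar>y\<bar> - s n)\<^sup>2 + \<bar>y\<bar> * s n" using s by simp
      then have "\<bar>y\<bar> * s n \<le> y\<^sup>2 + s n * s n" by (simp add: power2_eq_square algebra_simps)
      then show ?thesis using s by (simp add: field_simps)
    qed
    then have "urn_expectation n (\<lambda>A B. \<bar>urn_gap A B\<bar>)
        \<le> urn_expectation n (\<lambda>A B. (1 / s n) * (urn_gap A B)\<^sup>2 + s n)"
      by (intro urn_expectation_mono n)
    also have "\<dots> = (1 / s n) * urn_expectation n (\<lambda>A B. (urn_gap A B)\<^sup>2) + s n"
      unfolding urn_expectation_add urn_expectation_cmult by (simp add: urn_expectation_def)
    also have "\<dots> \<le> (1 / s n) * (30 * urn_expectation n urn_weight) + s n"
      using s expectation_gap_square[OF n] by (intro add_mono mult_left_mono) auto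
    finally have "urn_expectation n (\<lambda>A B. \<bar>urn_gap A B\<bar>) / real n powr lam
        \<le> ((1 / s n) * (30 * urn_expectation n urn_weight) + s n) / real n powr lam"
      by (intro divide_right_mono) auto
    moreover have "0 \<le> urn_expectation n (\<lambda>A B. \<bar>urn_gap A B\<bar>)"
      by (simp add: urn_expectation_def)
    ultimately show ?thesis by (simp add: add_divide_distrib mult_ac)
  qed
  show ?thesis
    by (rule Lim_null_comparison[OF eventually_sequentiallyI[OF bound]]) (use lim in auto)
qed

text \<open>The weight alone decides the order. The eigenvalue of the gap is below -1, outside the
  range of \<open>gbinomial_shift_asymp\<close>, so its mean is bounded through
  \<open>expectation_gap_abs\<close>.\<close>

lemma expected_sink_degree_asymp:
  "asymp_equiv expected_sink_degree sequentially
    (\<lambda>n. (1 + sqrt 2) / 2 * (real n powr (sqrt 2 - 1) / Gamma (sqrt 2)))"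
proof (rule asymp_equivI')
  let ?c = "(1 + sqrt 2) / 2 / Gamma (sqrt 2)"
  have Gpos: "Gamma (sqrt 2) > 0" by simp
  have cpos: "?c > 0" by (intro divide_pos_pos Gpos) (simp_all add: add_pos_pos)
  have "\<bar>urn_expectation n urn_gap\<bar> \<le> urn_expectation n (\<lambda>A B. \<bar>urn_gap A B\<bar>)" for n
    unfolding urn_expectation_def by (rule integral_abs_bound)
  then have gap: "(\<lambda>n. urn_expectation n urn_gap / real n powr lam) \<longlonglongrightarrow> 0"
    by (intro Lim_null_comparison[OF always_eventually expectation_gap_abs] allI)
      (simp only: real_norm_def abs_divide abs_of_nonneg[OF powr_ge_zero] divide_right_mono powr_ge_zero)
  have "(\<lambda>n. (limit_coeff 1 * (urn_expectation n urn_weight / real n powr lam)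
      + (1 / (2 * sqrt 2) - 1 / 2) * (urn_expectation n urn_gap / real n powr lam)) / ?c)
      \<longlonglongrightarrow> (limit_coeff 1 * (sqrt 2 / Gamma (sqrt 2)) + (1 / (2 * sqrt 2) - 1 / 2) * 0) / ?c"
    using cpos by (intro tendsto_divide tendsto_add tendsto_mult tendsto_const gap expectation_weight_asymp) auto
  also have "(limit_coeff 1 * (sqrt 2 / Gamma (sqrt 2)) + (1 / (2 * sqrt 2) - 1 / 2) * 0) / ?c = 1"
  proof -
    have "limit_coeff 1 * (sqrt 2 / Gamma (sqrt 2)) = ?c" by (simp add: limit_coeff_1)
    moreover have "?c / ?c = 1" by (rule divide_self[OF less_imp_neq[OF cpos, symmetric]])
    ultimately show ?thesis by (simp only: mult_zero_right add_0_right)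
  qed
  finally show "(\<lambda>n. expected_sink_degree n / ((1 + sqrt 2) / 2 * (real n powr (sqrt 2 - 1) / Gamma (sqrt 2)))) \<longlonglongrightarrow> 1"
  proof (rule Lim_transform_eventually)
    show "\<forall>\<^sub>F n in sequentially. (limit_coeff 1 * (urn_expectation n urn_weight / real n powr lam)
      + (1 / (2 * sqrt 2) - 1 / 2) * (urn_expectation n urn_gap / real n powr lam)) / ?c
      = expected_sink_degree n / ((1 + sqrt 2) / 2 * (real n powr (sqrt 2 - 1) / Gamma (sqrt 2)))"
      using eventually_ge_at_top[of 1]
    proof eventually_elim
      case (elim n)
      have "(limit_coeff 1 * (urn_expectation n urn_weight / real n powr lam)
          + (1 / (2 * sqrt 2) - 1 / 2) * (urn_expectation n urn_gap / real n powr lam))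
          = expected_sink_degree n / real n powr lam"
        unfolding expected_sink_degree_decomp[OF elim] add_divide_distrib times_divide_eq_right ..
      then show ?case by (simp add: mult_ac)
    qed
  qed
qed

text \<open>The expectation of \<open>urn_poly (Suc r)\<close> is known exactly. It differs from
  that of its leading part by at most a constant times the r-th moment of the weight, which by
  induction has order n^(r lam) and vanishes after scaling by n^((r + 1) lam).\<close>

lemma weight_moments:
  "(\<lambda>n. urn_expectation n (\<lambda>A B. (limit_coeff 1 * urn_weight A B) ^ r) / real n powr (real r * lam))
    \<longlonglongrightarrow> limit_moment r"
proof (induction r)
  case 0
  \<comment> \<open>n = 0 is excluded because \<open>0 powr 0\<close> is 0.\<close>
  have "\<forall>\<^sub>F n in sequentially. 1 = urn_expectation n (\<lambda>A B. (limit_coeff 1 * urn_weight A B) ^ 0) / real n powr (real 0 * lam)"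
    using eventually_ge_at_top[of 1] by eventually_elim (simp add: urn_expectation_def)
  moreover have "limit_moment 0 = 1" by (simp add: limit_moment_def limit_coeff_0)
  ultimately show ?case by (simp only:) (rule Lim_transform_eventually[OF tendsto_const])
next
  case (Suc r)
  let ?c = "limit_coeff 1" and ?R = "real (Suc r) * lam"
  let ?w = "\<lambda>A B. ?c * urn_weight A B"
  let ?T = "\<lambda>n. urn_expectation n (\<lambda>A B. ?w A B ^ r)"
  let ?d = "\<lambda>A B. urn_poly (Suc r) A B - ?w A B ^ Suc r / fact (Suc r)"
  have c: "0 < ?c" by (simp add: limit_coeff_1 add_pos_pos)
  obtain K where K: "\<And>A B. A + B > 0 \<Longrightarrow> \<bar>?d A B\<bar> * urn_weight A B \<le> K * urn_weight A B ^ Suc r"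
    using urn_poly_leading[of "Suc r"] by blast
  have d_le: "\<bar>?d A B\<bar> \<le> K / ?c ^ r * ?w A B ^ r" if "A + B > 0" for A B
  proof -
    have u: "0 < urn_weight A B" using urn_weight_ge1[OF that] by simp
    have "\<bar>?d A B\<bar> * urn_weight A B \<le> (K * urn_weight A B ^ r) * urn_weight A B"
      using K[OF that] by (simp only: power_Suc mult_ac)
    then have "\<bar>?d A B\<bar> \<le> K * urn_weight A B ^ r" using u by (rule mult_right_le_imp_le)
    also have "\<dots> = K / ?c ^ r * ?w A B ^ r" using c by (simp add: power_mult_distrib)
    finally show ?thesis .
  qed
  have Ed: "\<bar>urn_expectation n ?d\<bar> \<le> K / ?c ^ r * ?T n" if "n \<ge> 1" for n
  proof -
    have "\<bar>urn_expectation n ?d\<bar> \<le> urn_expectation n (\<lambda>A B. \<bar>?d A B\<bar>)"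
      unfolding urn_expectation_def by (rule integral_abs_bound)
    also have "\<dots> \<le> urn_expectation n (\<lambda>A B. K / ?c ^ r * ?w A B ^ r)"
      using d_le that by (rule urn_expectation_mono)
    finally show ?thesis by (simp only: urn_expectation_cmult)
  qed
  have d0: "(\<lambda>n. urn_expectation n ?d / real n powr ?R) \<longlonglongrightarrow> 0"
  proof (rule Lim_null_comparison)
    have "(\<lambda>n. real n powr (- lam)) \<longlonglongrightarrow> 0" using lam_bounds by real_asymp
    then have "(\<lambda>n. K / ?c ^ r * ((?T n / real n powr (real r * lam)) * real n powr (- lam))) \<longlonglongrightarrow> K / ?c ^ r * (limit_moment r * 0)"
      using Suc.IH by (intro tendsto_mult tendsto_const)
    then show "(\<lambda>n. K / ?c ^ r * ((?T n / real n powr (real r * lam)) * real n powr (- lam))) \<longlonglongrightarrow> 0" by simp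
    show "\<forall>\<^sub>F n in sequentially. norm (urn_expectation n ?d / real n powr ?R)
        \<le> K / ?c ^ r * ((?T n / real n powr (real r * lam)) * real n powr (- lam))"
      using eventually_ge_at_top[of 1]
    proof eventually_elim
      case (elim n)
      have "?R = real r * lam + lam" by (simp add: algebra_simps)
      then have "real n powr ?R = real n powr (real r * lam) * real n powr lam"
        by (simp only: powr_add)
      then have "K / ?c ^ r * ((?T n / real n powr (real r * lam)) * real n powr (- lam))
          = K / ?c ^ r * ?T n / real n powr ?R"
        by (simp only: powr_minus divide_inverse inverse_mult_distrib mult.assoc)
      moreover have "\<bar>urn_expectation n ?d\<bar> / real n powr ?R \<le> K / ?c ^ r * ?T n / real n powr ?R"
        using Ed[OF elim] by (intro divide_right_mono) auto
      ultimately show ?case by (simp only: real_norm_def abs_divide abs_of_nonneg[OF powr_ge_zero])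
    qed
  qed
  have P: "(\<lambda>n. urn_expectation n (urn_poly (Suc r)) / real n powr ?R)
      \<longlonglongrightarrow> (?R + 1) * limit_coeff (Suc r) * (1 / Gamma (?R + 1))"
  proof (rule Lim_transform_eventually)
    have "?R > - 1" using lam_bounds by (intro less_le_trans[OF _ mult_nonneg_nonneg]) auto
    then show "(\<lambda>n. (?R + 1) * limit_coeff (Suc r) * (((real n - 1 + ?R) gchoose (n - 1)) / real n powr ?R))
        \<longlonglongrightarrow> (?R + 1) * limit_coeff (Suc r) * (1 / Gamma (?R + 1))"
      by (intro tendsto_mult tendsto_const gbinomial_shift_asymp)
    show "\<forall>\<^sub>F n in sequentially. (?R + 1) * limit_coeff (Suc r) * (((real n - 1 + ?R) gchoose (n - 1)) / real n powr ?R)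
        = urn_expectation n (urn_poly (Suc r)) / real n powr ?R"
      using eventually_ge_at_top[of 1]
      by eventually_elim
        (simp only: urn_expectation_eigen[OF drift_poly] urn_poly_init times_divide_eq_right)
  qed
  \<comment> \<open>Eigenfunction minus error is the leading part, the power over (r + 1)!; clearing
    this denominator produces the factorial in \<open>limit_moment\<close>.\<close>
  have "(\<lambda>n. fact (Suc r) * (urn_expectation n (urn_poly (Suc r)) / real n powr ?R - urn_expectation n ?d / real n powr ?R))
      \<longlonglongrightarrow> fact (Suc r) * ((?R + 1) * limit_coeff (Suc r) * (1 / Gamma (?R + 1)) - 0)"
    by (intro tendsto_mult tendsto_diff tendsto_const P d0)
  also have "fact (Suc r) * ((?R + 1) * limit_coeff (Suc r) * (1 / Gamma (?R + 1)) - 0) = limit_moment (Suc r)"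
    by (simp only: limit_moment_def diff_0_right times_divide_eq_right mult_1_right mult.assoc)
  also have "(\<lambda>n. fact (Suc r) * (urn_expectation n (urn_poly (Suc r)) / real n powr ?R - urn_expectation n ?d / real n powr ?R))
      = (\<lambda>n. urn_expectation n (\<lambda>A B. ?w A B ^ Suc r) / real n powr ?R)"
  proof
    fix n
    have cancel: "fact (Suc r) * (p / x - (p - w / fact (Suc r)) / x) = w / x" for p w x :: real
      by (simp add: diff_divide_distrib del: fact_Suc)
    have "urn_expectation n ?d = urn_expectation n (urn_poly (Suc r)) - urn_expectation n (\<lambda>A B. ?w A B ^ Suc r) / fact (Suc r)"
      unfolding urn_expectation_def
      by (subst Bochner_Integration.integral_diff[OF integrable_binary_model integrable_binary_model])
        (simp only: Bochner_Integration.integral_divide_zero)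
    then show "fact (Suc r) * (urn_expectation n (urn_poly (Suc r)) / real n powr ?R - urn_expectation n ?d / real n powr ?R)
        = urn_expectation n (\<lambda>A B. ?w A B ^ Suc r) / real n powr ?R"
      by (simp only: cancel)
  qed
  finally show ?case .
qed

text \<open>The method of moments is applied to the scaled weight \<open>W\<close>; the scaled
  degree differs from it by a multiple of the scaled gap, which vanishes in mean.\<close>

lemma sink_degree_limit:
  obtains D where "real_distribution D" "weak_conv_m scaled_sink_degree_law D" "has_moments D limit_moment"
proof -
  define W where "W n N = limit_coeff 1 * urn_weight (thin_degree N) (thick_degree N) / real n powr lam" for n N
  define \<mu> where "\<mu> n = distr (measure_pmf (binary_model n)) borel (W n)" for n
  have \<mu>: "real_distribution (\<mu> n)" for n
    unfolding \<mu>_def by (intro prob_space.real_distribution_distr prob_space_measure_pmf) simp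
  have int: "integrable (\<mu> n) (\<lambda>x. x ^ r)" for n r
    unfolding \<mu>_def by (subst integrable_distr_eq) (simp_all add: integrable_binary_model)
  have moment: "integral\<^sup>L (\<mu> n) (\<lambda>x. x ^ r)
      = urn_expectation n (\<lambda>A B. (limit_coeff 1 * urn_weight A B) ^ r) / real n powr (real r * lam)"
    if "n \<ge> 1" for n r
  proof -
    have "(real n powr lam) ^ r = real n powr (real r * lam)"
      using that by (simp add: powr_powr mult.commute flip: powr_realpow)
    then show ?thesis
      unfolding \<mu>_def by (subst integral_distr) (simp_all add: W_def urn_expectation_def power_divide)
  qed
  have lim: "(\<lambda>n. integral\<^sup>L (\<mu> n) (\<lambda>x. x ^ r)) \<longlonglongrightarrow> limit_moment r" for r
    by (rule Lim_transform_eventually[OF weight_moments])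
      (auto intro!: eventually_sequentiallyI[of 1] simp: moment)
  obtain D where D: "real_distribution D" "weak_conv_m \<mu> D" "has_moments D limit_moment"
    by (rule method_of_moments[OF \<mu> int lim, where k="\<lambda>j. 3 * j"]) (rule limit_moment_small)
  let ?\<kappa> = "1 / (2 * sqrt 2) - 1 / 2"
  have diff: "integral\<^sup>L (measure_pmf (binary_model n)) (\<lambda>N. \<bar>real (sink_degree N) / real n powr lam - W n N\<bar>)
      = \<bar>?\<kappa>\<bar> * (urn_expectation n (\<lambda>A B. \<bar>urn_gap A B\<bar>) / real n powr lam)" if n: "n \<ge> 1" for n
  proof -
    have "integral\<^sup>L (measure_pmf (binary_model n)) (\<lambda>N. \<bar>real (sink_degree N) / real n powr lam - W n N\<bar>)
        = integral\<^sup>L (measure_pmf (binary_model n)) (\<lambda>N. \<bar>?\<kappa>\<bar> * (\<bar>urn_gap (thin_degree N) (thick_degree N)\<bar> / real n powr lam))"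
    proof (rule integral_cong_AE, simp, simp, rule AE_pmfI)
      fix N assume "N \<in> set_pmf (binary_model n)"
      from binary_model_admissible(1)[OF n this] have "real (sink_degree N) = real (thin_degree N) + real (thick_degree N)"
        by (simp add: sink_degree_eq thin_degree_def thick_degree_def)
      then have "real (sink_degree N) / real n powr lam - W n N
          = ?\<kappa> * urn_gap (thin_degree N) (thick_degree N) / real n powr lam"
        unfolding total_eq W_def by (simp only: add_divide_distrib add_diff_cancel_left')
      then show "\<bar>real (sink_degree N) / real n powr lam - W n N\<bar>
          = \<bar>?\<kappa>\<bar> * (\<bar>urn_gap (thin_degree N) (thick_degree N)\<bar> / real n powr lam)"
        by (simp only: abs_mult abs_divide abs_of_nonneg[OF powr_ge_zero] times_divide_eq_right)
    qed
    then show ?thesis by (simp add: urn_expectation_def)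
  qed
  have "(\<lambda>n. \<bar>?\<kappa>\<bar> * (urn_expectation n (\<lambda>A B. \<bar>urn_gap A B\<bar>) / real n powr lam)) \<longlonglongrightarrow> 0"
    by (rule tendsto_mult_right_zero[OF expectation_gap_abs])
  then have close: "(\<lambda>n. integral\<^sup>L (measure_pmf (binary_model n)) (\<lambda>N. \<bar>real (sink_degree N) / real n powr lam - W n N\<bar>)) \<longlonglongrightarrow> 0"
    by (rule Lim_transform_eventually) (auto intro!: eventually_sequentiallyI[of 1] simp only: diff)
  have "weak_conv_m scaled_sink_degree_law D"
    unfolding scaled_sink_degree_law_def[abs_def]
    using weak_conv_m_L1_close[OF prob_space_measure_pmf _ _ integrable_binary_model close D(1) D(2)[unfolded \<mu>_def[abs_def]]]
    by simp
  with D show ?thesis by (intro that)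
qed

theorem theorem6:
  shows "(\<forall>n\<ge>1. expected_sink_degree n =
            (1 + sqrt 2) / 2 * ((real n + sqrt 2 - 2) gchoose (n - 1))
            - (sqrt 2 - 1) / 2 * ((real n - sqrt 2 - 2) gchoose (n - 1)))
    \<and> asymp_equiv expected_sink_degree sequentially
        (\<lambda>n. (1 + sqrt 2) / 2 * (real n powr (sqrt 2 - 1) / Gamma (sqrt 2)))
    \<and> (\<exists>D. real_distribution D
          \<and> weak_conv_m scaled_sink_degree_law D
          \<and> has_moments D limit_moment
          \<and> (\<forall>D'. real_distribution D' \<and> has_moments D' limit_moment \<longrightarrow> D' = D))"
proof (intro conjI)
  show "\<forall>n\<ge>1. expected_sink_degree n =
      (1 + sqrt 2) / 2 * ((real n + sqrt 2 - 2) gchoose (n - 1))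
      - (sqrt 2 - 1) / 2 * ((real n - sqrt 2 - 2) gchoose (n - 1))"
    using expected_sink_degree_exact by blast
  obtain D where D: "real_distribution D" "weak_conv_m scaled_sink_degree_law D" "has_moments D limit_moment"
    by (rule sink_degree_limit)
  \<comment> \<open>This is the sense in which the moments characterize the limit.\<close>
  have "D' = D" if "real_distribution D'" "has_moments D' limit_moment" for D'
    by (rule moment_determinacy[OF that D(1,3), where k="\<lambda>j. 3 * j"]) (rule limit_moment_small)
  with D show "\<exists>D. real_distribution D
      \<and> weak_conv_m scaled_sink_degree_law D
      \<and> has_moments D limit_moment
      \<and> (\<forall>D'. real_distribution D' \<and> has_moments D' limit_moment \<longrightarrow> D' = D)"
    by blast
qed (rule expected_sink_degree_asymp)

end
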